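(* Let $k\ge 2$ be an integer and let $G$ be a connected graph of order $n$ with $n \geq (2k+1)^{20+23(k-1)r_{0.0097}}$. Then $S_k(G)< 2k$ if and only if $G$ is isomorphic to one of $Y_n,\ W_n,\ P_n,\ C_n$.
   Context: All graphs are finite, simple and undirected. For a graph $G$ of order $n$ (number of vertices), $\lambda_1(G)\ge\cdots\ge\lambda_n(G)$ are the eigenvalues of its adjacency matrix, and for $1\le k\le n$, $S_k(G)=\sum_{i=1}^k\lambda_i(G)$. For an integer $k\ge 2$ and a real $0<\varepsilon\le 1$, define $r_\varepsilon=\left\lceil\frac{\pi}{\arccos(1-\varepsilon/(k-1))}\right\rceil-1$ (it depends on $k$); $r_{0.0097}$ is this quantity with $\varepsilon=0.0097$. $P_n$ and $C_n$ are the path and the cycle of order $n$. Write $P_n=v_1v_2\cdots v_n$. The graph $Y_n$ is obtained from $P_n$ by deleting the edge $v_1v_2$ and adding the edge $v_1v_3$. For $n\ge 6$, $W_n$ is obtained from $P_n$ by deleting the edges $v_1v_2$ and $v_{n-1}v_n$ and adding the edges $v_1v_3$ and $v_{n-2}v_n$. *)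

theory Defs
  imports
    Complex_Main
    "Graph_Theory.Pair_Digraph"
    "Graph_Theory.Digraph_Component"
    "Graph_Theory.Digraph_Isomorphism"
    "Jordan_Normal_Form.Char_Poly"
begin

text \<open>
  Finite simple undirected graphs are the finite symmetric loop-free relations of
  \<^locale>\<open>pair_graph\<close>: an edge \<open>{u, v}\<close> is represented by both arcs \<open>(u, v)\<close> and \<open>(v, u)\<close>.
\<close>

definition vertex_enum :: "'a pair_pre_digraph \<Rightarrow> 'a list" where
  "vertex_enum G = (SOME vs. distinct vs \<and> set vs = pverts G)"

text \<open>
  Another enumeration of the vertices conjugates the adjacency matrix by a permutation
  matrix, so the spectrum below does not depend on the choice.
\<close>

definition adjacency_matrix :: "'a pair_pre_digraph \<Rightarrow> real mat" where
  "adjacency_matrix G =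
     (let vs = vertex_enum G; n = card (pverts G)
      in mat n n (\<lambda>(i, j). if (vs ! i, vs ! j) \<in> parcs G then 1 else 0))"

text \<open>
  The roots of the characteristic polynomial, repeated according to multiplicity, in
  non-increasing order. The adjacency matrix of an undirected graph is real symmetric,
  so all \<open>n\<close> eigenvalues are real and occur in this list.
\<close>

definition spectrum_list :: "'a pair_pre_digraph \<Rightarrow> real list" where
  "spectrum_list G = rev (sorted_list_of_multiset (proots (char_poly (adjacency_matrix G))))"

text \<open>Indexed from 1; meaningful for \<open>1 \<le> i\<close> and \<open>i\<close> at most the order of the graph.\<close>

definition graph_eigenvalue :: "'a pair_pre_digraph \<Rightarrow> nat \<Rightarrow> real" where
  "graph_eigenvalue G i = spectrum_list G ! (i - 1)"

definition eigenvalue_sum :: "nat \<Rightarrow> 'a pair_pre_digraph \<Rightarrow> real" where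
  "eigenvalue_sum k G = (\<Sum>i = 1..k. graph_eigenvalue G i)"

definition r_eps :: "real \<Rightarrow> nat \<Rightarrow> int" where
  "r_eps \<epsilon> k = \<lceil>pi / arccos (1 - \<epsilon> / (real k - 1))\<rceil> - 1"

definition insert_edge :: "'a \<Rightarrow> 'a \<Rightarrow> 'a pair_pre_digraph \<Rightarrow> 'a pair_pre_digraph" where
  "insert_edge u v G = G\<lparr>parcs := parcs G \<union> {(u, v), (v, u)}\<rparr>"

definition delete_edge :: "'a \<Rightarrow> 'a \<Rightarrow> 'a pair_pre_digraph \<Rightarrow> 'a pair_pre_digraph" where
  "delete_edge u v G = G\<lparr>parcs := parcs G - {(u, v), (v, u)}\<rparr>"

text \<open>The vertex \<open>v\<^sub>i\<close> of the path is the number \<open>i\<close>.\<close>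

definition P_graph :: "nat \<Rightarrow> nat pair_pre_digraph" where
  "P_graph n = \<lparr>pverts = {1..n},
     parcs = {(u, v). u \<in> {1..n} \<and> v \<in> {1..n} \<and> (v = u + 1 \<or> u = v + 1)}\<rparr>"

text \<open>A cycle for \<open>n \<ge> 3\<close>.\<close>

definition C_graph :: "nat \<Rightarrow> nat pair_pre_digraph" where
  "C_graph n = insert_edge n 1 (P_graph n)"

text \<open>Meaningful for \<open>n \<ge> 3\<close>.\<close>

definition Y_graph :: "nat \<Rightarrow> nat pair_pre_digraph" where
  "Y_graph n = insert_edge 1 3 (delete_edge 1 2 (P_graph n))"

text \<open>Meaningful for \<open>n \<ge> 6\<close>.\<close>

definition W_graph :: "nat \<Rightarrow> nat pair_pre_digraph" where
  "W_graph n = insert_edge (n - 2) n (insert_edge 1 3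
     (delete_edge (n - 1) n (delete_edge 1 2 (P_graph n))))"

definition graph_iso :: "'a pair_pre_digraph \<Rightarrow> 'b pair_pre_digraph \<Rightarrow> bool" where
  "graph_iso G H \<longleftrightarrow> digraph_iso (with_proj G) (with_proj H)"

end

theory Submission
  imports
    Defs
    "HOL-Combinatorics.Permutations"
begin

text \<open>
  By Ky Fan's principle, unit test vectors with disjoint supports bound \<open>S\<^sub>k\<close> from below by the sum
  of their quadratic forms. Suppose that some vertex \<open>u\<close> of degree at least 3 is not a fork, i.e. not of
  degree 3 with two pendant neighbours. If some degree is at least \<open>4k\<^sup>2\<close>, a star and \<open>k - 1\<close> single
  vertices give \<open>S\<^sub>k \<ge> 2k\<close>. Otherwise balls grow so slowly that a long geodesic starts at \<open>u\<close>: near \<open>u\<close>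
  there is a small subgraph of index at least 2.0194, and the rest of the geodesic contains \<open>k - 1\<close>
  disjoint paths of order \<open>r\<close>, each of index \<open>2 cos (\<pi> / (r + 1)) \<ge> 2 - 0.0194 / (k - 1)\<close>.

  If all vertices of degree at least 3 are forks, a longest path misses at most one pendant vertex at
  either end, which leaves the four graphs of the theorem. On these, the function that is 1/2 at the
  pendant vertices of forks and 1 elsewhere is a positive supersolution of \<open>A h = 2 h\<close>, so that 2 bounds
  the spectrum and is at most a simple eigenvalue.
\<close>

section \<open>Real symmetric matrices\<close>

text \<open>The four graphs are the only connected graphs of large order with index at most 2:
  \<open>P_n\<close> and \<open>Y_n\<close> stay below 2, while \<open>C_n\<close> and
  \<open>W_n\<close> attain it. Strictness of \<open>S_k < 2k\<close> therefore cannot come from the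
  largest eigenvalue and is obtained from the second. Forks are singled out because a tree with arms
  of lengths 1, 1 and m has index below 2 for every m, so degree 3 by itself forces nothing. Any
  other vertex of degree at least 3, given a long enough arm, lifts the index past 2 by a fixed
  amount. This surplus 0.0194 = 2 * 0.0097 pays for all the paths, whose deficits of at most 0.0194
  / (k - 1) add up to no more than that. A geodesic is used rather than an arbitrary long path
  because the distance from \<open>u\<close> tells its pieces apart and keeps them away from the
  small subgraph.\<close>

lemma symmetric_real_eigenvalue_exists:
  fixes A :: "real mat"
  assumes A: "A \<in> carrier_mat n n" and sym: "transpose_mat A = A" and n: "n > 0"
  shows "\<exists>e. eigenvalue A e"
proof -
  let ?C = "map_mat complex_of_real A"
  have C: "?C \<in> carrier_mat n n" using A by simp
  have "\<not> constant (poly (char_poly ?C))"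
    using degree_monic_char_poly[OF C] n by (simp add: constant_degree)
  then obtain z where z: "poly (char_poly ?C) z = 0"
    using fundamental_theorem_of_algebra by blast
  then obtain v where v: "v \<in> carrier_vec n" "v \<noteq> 0\<^sub>v n" "?C *\<^sub>v v = z \<cdot>\<^sub>v v"
    using eigenvalue_root_char_poly[OF C] C unfolding eigenvalue_def eigenvector_def by auto
  have Asym: "A $$ (i, j) = A $$ (j, i)" if "i < n" "j < n" for i j
    using sym A that by (metis carrier_matD index_transpose_mat(1))
  have Av: "(\<Sum>j<n. complex_of_real (A $$ (i, j)) * v $ j) = z * v $ i" if "i < n" for i
    using arg_cong[OF v(3), of "\<lambda>w. w $ i"] that A v(1)
    by (simp add: scalar_prod_def atLeast0LessThan)
  define s where "s = (\<Sum>i<n. (cmod (v $ i))\<^sup>2)"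
  \<comment> \<open>\<open>T\<close> is \<open>v* A v\<close>. It equals \<open>z\<close> times the
    squared norm of \<open>v\<close>, and by the symmetry of \<open>A\<close> it is its own
    conjugate, which makes \<open>z\<close> real.\<close>
  define T where "T = (\<Sum>i<n. \<Sum>j<n. cnj (v $ i) * (complex_of_real (A $$ (i, j)) * v $ j))"
  have "T = (\<Sum>i<n. cnj (v $ i) * (z * v $ i))"
    unfolding T_def sum_distrib_left[symmetric] using Av by (intro sum.cong) auto
  also have "\<dots> = z * of_real s"
    unfolding s_def of_real_sum sum_distrib_left
    by (intro sum.cong) (auto simp: complex_norm_square mult_ac simp del: of_real_power)
  finally have T1: "T = z * of_real s" .
  have "cnj T = (\<Sum>i<n. \<Sum>j<n. v $ i * (complex_of_real (A $$ (i, j)) * cnj (v $ j)))"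
    unfolding T_def by simp
  also have "\<dots> = T"
    unfolding T_def by (subst sum.swap) (intro sum.cong refl, simp add: Asym mult_ac)
  finally have "cnj z * of_real s = z * of_real s" using T1 by (metis complex_cnj_complex_of_real complex_cnj_mult)
  moreover have "s \<noteq> 0"
  proof
    assume "s = 0"
    hence "\<forall>i\<in>{..<n}. (cmod (v $ i))\<^sup>2 = 0" unfolding s_def by (subst (asm) sum_nonneg_eq_0_iff) auto
    hence "v = 0\<^sub>v n" using v(1) by (intro eq_vecI) auto
    thus False using v(2) by simp
  qed
  ultimately have "cnj z = z" by simp
  then obtain e where e: "z = complex_of_real e" by (metis Reals_cnj_iff Reals_cases)
  \<comment> \<open>The eigenvector \<open>v\<close> may be complex, so reality is passed on through
    the characteristic polynomial: a real root of its complexification is a root of the real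
    polynomial.\<close>
  have "complex_of_real (poly (char_poly A) e) = poly (map_poly complex_of_real (char_poly A)) z"
    unfolding e by simp
  also have "\<dots> = 0" using z of_real_hom.char_poly_hom[OF A, where ?'a = complex] by simp
  finally have "poly (char_poly A) e = 0" by simp
  thus ?thesis using eigenvalue_root_char_poly[OF A] by blast
qed

text \<open>The reflection along \<open>v - e_0\<close> exchanges \<open>e_0\<close> and
  \<open>v\<close>. It completes a unit vector to an orthogonal matrix without Gram-Schmidt, and it
  is its own inverse.\<close>

lemma householder_reflection:
  fixes v :: "real vec"
  assumes v: "v \<in> carrier_vec n" and n: "n > 0" and unit: "v \<bullet> v = 1"
  shows "\<exists>P \<in> carrier_mat n n. transpose_mat P = P \<and> P * P = 1\<^sub>m n \<and> col P 0 = v"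
proof -
  define w where "w i = v $ i - (if i = 0 then 1 else 0)" for i
  define S where "S = (\<Sum>i<n. (w i)\<^sup>2)"
  \<comment> \<open>If \<open>v\<close> is \<open>e_0\<close>, then \<open>S = 0\<close> and
    division by zero gives \<open>c = 0\<close>, so that \<open>P\<close> is the identity, as it
    should be.\<close>
  define c where "c = 2 / S"
  define P where "P = mat n n (\<lambda>(i, j). (if i = j then 1 else 0) - c * w i * w j)"
  have P: "P \<in> carrier_mat n n" unfolding P_def by simp
  have v2: "(\<Sum>i<n. (v $ i)\<^sup>2) = 1"
    using unit v by (simp add: scalar_prod_def atLeast0LessThan power2_eq_square)
  have "S = (\<Sum>i<n. (v $ i)\<^sup>2 - 2 * (if i = 0 then v $ i else 0) + (if i = 0 then 1 else 0))"
    unfolding S_def w_def by (intro sum.cong) (auto simp: power2_diff)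
  also have "\<dots> = 1 - 2 * v $ 0 + 1"
    using n by (simp add: sum.distrib sum_subtractf v2 sum_distrib_left[symmetric] sum.delta)
  finally have S: "S = - 2 * w 0" by (simp add: w_def)
  have ccS: "c * c * S = 2 * c" unfolding c_def by (cases "S = 0") auto
  have "P * P = 1\<^sub>m n"
  proof (rule eq_matI)
    fix i j assume "i < dim_row (1\<^sub>m n :: real mat)" "j < dim_col (1\<^sub>m n :: real mat)"
    hence ij: "i < n" "j < n" by auto
    have "(P * P) $$ (i, j) = (\<Sum>k<n. ((if i = k then 1 else 0) - c * w i * w k) * ((if k = j then 1 else 0) - c * w k * w j))"
      using ij by (simp add: P_def scalar_prod_def atLeast0LessThan)
    also have "\<dots> = (\<Sum>k<n. (if k = i then (if i = j then 1 else 0) else 0) - (if k = i then c * w i * w j else 0)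
        - (if k = j then c * w i * w j else 0) + (c * c * w i * w j) * (w k)\<^sup>2)"
      by (intro sum.cong) (auto simp: algebra_simps power2_eq_square)
    also have "\<dots> = (if i = j then 1 else 0) - 2 * (c * w i * w j) + (c * c * w i * w j) * S"
      using ij by (simp add: sum.distrib sum_subtractf S_def sum_distrib_left)
    also have "\<dots> = (if i = j then 1 else 0) + (c * c * S - 2 * c) * (w i * w j)"
      by (simp add: algebra_simps)
    finally show "(P * P) $$ (i, j) = 1\<^sub>m n $$ (i, j)" using ij ccS by simp
  qed (auto simp: P_def)
  moreover have "transpose_mat P = P"
    unfolding P_def by (rule eq_matI) (auto simp: mult_ac)
  moreover have "col P 0 = v"
  proof (rule eq_vecI)
    fix i assume "i < dim_vec v"
    hence i: "i < n" using v by simp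
    have "w i = 0" if "S = 0"
    proof -
      from that i have "(w i)\<^sup>2 = 0" unfolding S_def by (subst (asm) sum_nonneg_eq_0_iff) auto
      thus ?thesis by simp
    qed
    hence "c * w i * w 0 = - w i"
      using S unfolding c_def by (cases "S = 0") (auto simp: field_simps)
    hence "col P 0 $ i = (if i = 0 then 1 else 0) + w i"
      using i n unfolding P_def by simp
    thus "col P 0 $ i = v $ i" by (simp add: w_def)
  qed (use v P in auto)
  ultimately show ?thesis using P by blast
qed

text \<open>Deflation: after conjugation with a reflection \<open>P\<close> whose first column is a
  unit eigenvector, \<open>e_0\<close> is an eigenvector. Symmetry then clears the first row along
  with the first column, and the induction hypothesis applies to the remaining block.\<close>

theorem real_spectral_theorem:
  fixes A :: "real mat"
  assumes "A \<in> carrier_mat n n" and "transpose_mat A = A"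
  shows "\<exists>Q d. Q \<in> carrier_mat n n \<and> transpose_mat Q * Q = 1\<^sub>m n \<and>
    A = Q * mat n n (\<lambda>(i, j). if i = j then d i else 0) * transpose_mat Q"
  using assms
proof (induction n arbitrary: A)
  case 0
  show ?case by (rule exI[of _ "1\<^sub>m 0"]) (use 0 in \<open>auto intro!: eq_matI\<close>)
next
  case (Suc n)
  note A = Suc.prems(1) and sym = Suc.prems(2)
  obtain e x where ex: "x \<in> carrier_vec (Suc n)" "x \<noteq> 0\<^sub>v (Suc n)" "A *\<^sub>v x = e \<cdot>\<^sub>v x"
    using symmetric_real_eigenvalue_exists[OF A sym] A unfolding eigenvalue_def eigenvector_def by auto
  define v where "v = (1 / sqrt (x \<bullet> x)) \<cdot>\<^sub>v x"
  have v: "v \<in> carrier_vec (Suc n)" using ex by (simp add: v_def)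
  have xx: "x \<bullet> x > 0"
  proof (rule ccontr)
    assume "\<not> x \<bullet> x > 0"
    moreover have "x \<bullet> x = (\<Sum>i<Suc n. (x $ i)\<^sup>2)"
      using ex by (simp only: scalar_prod_def carrier_vecD atLeast0LessThan power2_eq_square)
    moreover have "(\<Sum>i<Suc n. (x $ i)\<^sup>2) \<ge> 0" by (intro sum_nonneg) auto
    ultimately have "(\<Sum>i<Suc n. (x $ i)\<^sup>2) = 0" by linarith
    hence "\<forall>i\<in>{..<Suc n}. (x $ i)\<^sup>2 = 0" by (subst (asm) sum_nonneg_eq_0_iff) auto
    hence "x = 0\<^sub>v (Suc n)" using ex(1) by (intro eq_vecI) auto
    thus False using ex(2) by simp
  qed
  have unit: "v \<bullet> v = 1"
    using xx ex(1) by (simp add: v_def)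
  have Av: "A *\<^sub>v v = e \<cdot>\<^sub>v v"
    using ex A by (simp add: v_def mult_mat_vec smult_smult_assoc mult.commute)
  obtain P where P: "P \<in> carrier_mat (Suc n) (Suc n)" "transpose_mat P = P" "P * P = 1\<^sub>m (Suc n)" "col P 0 = v"
    using householder_reflection[OF v _ unit] by auto
  define B where "B = P * A * P"
  have B: "B \<in> carrier_mat (Suc n) (Suc n)" using P A by (simp add: B_def)
  have Bsym: "transpose_mat B = B"
    using P A sym by (simp add: B_def transpose_mult[of _ "Suc n" "Suc n" _ "Suc n"] assoc_mult_mat[of _ "Suc n" "Suc n" _ "Suc n" _ "Suc n"])
  have "col B 0 = (P * A) *\<^sub>v v"
    unfolding B_def P(4)[symmetric] by (rule col_mult2[of _ "Suc n" "Suc n" _ "Suc n"]) (use P A in auto)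
  also have "\<dots> = P *\<^sub>v (A *\<^sub>v v)" by (rule assoc_mult_mat_vec[OF P(1) A v])
  also have "\<dots> = P *\<^sub>v (e \<cdot>\<^sub>v v)" unfolding Av ..
  also have "\<dots> = e \<cdot>\<^sub>v (P *\<^sub>v col P 0)" using P v by (simp add: mult_mat_vec)
  also have "P *\<^sub>v col P 0 = col (P * P) 0" by (rule col_mult2[symmetric, of _ "Suc n" "Suc n" _ "Suc n"]) (use P(1) in auto)
  also have "\<dots> = unit_vec (Suc n) 0" unfolding P(3) by simp
  finally have col0: "col B 0 = e \<cdot>\<^sub>v unit_vec (Suc n) 0" .
  have Bi0: "B $$ (i, 0) = (if i = 0 then e else 0)" if "i < Suc n" for i
    using arg_cong[OF col0, of "\<lambda>v. v $ i"] that B by simp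
  have B0i: "B $$ (0, i) = (if i = 0 then e else 0)" if "i < Suc n" for i
    using Bi0[OF that] Bsym B that by (metis carrier_matD index_transpose_mat(1) zero_less_Suc)
  define B' where "B' = mat n n (\<lambda>(i, j). B $$ (Suc i, Suc j))"
  have B': "B' \<in> carrier_mat n n" by (simp add: B'_def)
  have BB: "B = four_block_mat (mat 1 1 (\<lambda>_. e)) (0\<^sub>m 1 n) (0\<^sub>m n 1) B'"
    using B Bi0 B0i by (intro eq_matI) (auto simp: B'_def)
  have "transpose_mat B' = B'"
    using Bsym B unfolding B'_def by (intro eq_matI) (auto, metis Suc_less_eq carrier_matD index_transpose_mat(1))
  from Suc.IH[OF B' this] obtain Q d where Q: "Q \<in> carrier_mat n n" "transpose_mat Q * Q = 1\<^sub>m n"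
    "B' = Q * mat n n (\<lambda>(i, j). if i = j then d i else 0) * transpose_mat Q" by blast
  let ?D = "mat n n (\<lambda>(i, j). if i = j then d i else 0) :: real mat"
  define d' where "d' i = (case i of 0 \<Rightarrow> e | Suc j \<Rightarrow> d j)" for i
  let ?D' = "mat (Suc n) (Suc n) (\<lambda>(i, j). if i = j then d' i else 0) :: real mat"
  define R where "R = four_block_mat (1\<^sub>m 1) (0\<^sub>m 1 n) (0\<^sub>m n 1) Q"
  have R: "R \<in> carrier_mat (Suc n) (Suc n)" using Q unfolding R_def by auto
  have RT: "transpose_mat R = four_block_mat (1\<^sub>m 1) (0\<^sub>m 1 n) (0\<^sub>m n 1) (transpose_mat Q)"
    unfolding R_def using Q by (subst transpose_four_block_mat) auto
  have RR: "transpose_mat R * R = 1\<^sub>m (Suc n)"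
    unfolding RT unfolding R_def using Q 
    by (subst mult_four_block_mat[where ?n1.0=1 and ?n2.0=n]) auto
  have DD: "?D' = four_block_mat (mat 1 1 (\<lambda>_. e)) (0\<^sub>m 1 n) (0\<^sub>m n 1) ?D"
    by (intro eq_matI) (auto simp: d'_def split: nat.splits)
  have "R * ?D' = four_block_mat (mat 1 1 (\<lambda>_. e)) (0\<^sub>m 1 n) (0\<^sub>m n 1) (Q * ?D)"
    unfolding DD unfolding R_def using Q by (subst mult_four_block_mat) auto
  hence "R * ?D' * transpose_mat R = B"
    unfolding RT BB Q(3) using Q(1) by simp (subst mult_four_block_mat, auto)
  hence "P * (R * ?D' * transpose_mat R) * P = P * B * P" by simp
  also have "\<dots> = (P * P) * A * (P * P)"
    using P(1) A unfolding B_def by (simp add: assoc_mult_mat[of _ "Suc n" "Suc n" _ "Suc n" _ "Suc n"])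
  also have "\<dots> = A" using A unfolding P(3) by simp
  finally have Aeq: "A = P * (R * ?D' * transpose_mat R) * P" by simp
  have "A = (P * R) * ?D' * transpose_mat (P * R)"
  proof -
    note carr = mult_carrier_mat[of _ "Suc n" "Suc n" _ "Suc n"]
      and assoc = assoc_mult_mat[of _ "Suc n" "Suc n" _ "Suc n" _ "Suc n"]
    have D': "?D' \<in> carrier_mat (Suc n) (Suc n)" and RT: "transpose_mat R \<in> carrier_mat (Suc n) (Suc n)"
      using R by auto
    have "P * (R * ?D' * transpose_mat R) * P = P * R * ?D' * (transpose_mat R * P)"
      by (simp only: assoc[OF carr[OF P(1) R] D' carr[OF RT P(1)]] assoc[OF P(1) R carr[OF D' carr[OF RT P(1)]]]
        assoc[OF P(1) carr[OF carr[OF R D'] RT] P(1)] assoc[OF carr[OF R D'] RT P(1)]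
        assoc[OF R D' carr[OF RT P(1)]])
    thus ?thesis using Aeq transpose_mult[OF P(1) R] P(2) by simp
  qed
  moreover have "transpose_mat (P * R) * (P * R) = transpose_mat R * (P * P) * R"
    using P(1,2) R by (simp add: transpose_mult[of _ "Suc n" "Suc n" _ "Suc n"] assoc_mult_mat[of _ "Suc n" "Suc n" _ "Suc n" _ "Suc n"])
  hence "transpose_mat (P * R) * (P * R) = 1\<^sub>m (Suc n)" using RR R P(3) by simp
  ultimately show ?case using P(1) R by (intro exI[of _ "P * R"] exI[of _ d']) auto
qed

section \<open>Ky Fan's maximum principle\<close>

text \<open>This is \<open>f^T A f\<close>: every edge occurs as two arcs and is counted
  twice.\<close>

definition quad_form :: "'a pair_pre_digraph \<Rightarrow> ('a \<Rightarrow> real) \<Rightarrow> real" where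
  "quad_form G f = (\<Sum>(u, v)\<in>parcs G. f u * f v)"

context pair_graph
begin

text \<open>Eigenvectors are functions on the vertices, so that nothing after this lemma depends on
  the enumeration behind \<open>adjacency_matrix\<close>. The third fact is completeness of the
  basis, the fourth the spectral decomposition of the adjacency matrix.\<close>

lemma orthonormal_eigenbasis:
  obtains U :: "nat \<Rightarrow> 'a \<Rightarrow> real" where
    "length (spectrum_list G) = card (pverts G)"
    "\<And>i j. i < card (pverts G) \<Longrightarrow> j < card (pverts G) \<Longrightarrow>
      (\<Sum>v\<in>pverts G. U i v * U j v) = (if i = j then 1 else 0)"
    "\<And>v w. v \<in> pverts G \<Longrightarrow> w \<in> pverts G \<Longrightarrow>
      (\<Sum>i<card (pverts G). U i v * U i w) = (if v = w then 1 else 0)"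
    "\<And>v w. v \<in> pverts G \<Longrightarrow> w \<in> pverts G \<Longrightarrow>
      (\<Sum>i<card (pverts G). spectrum_list G ! i * (U i v * U i w)) = (if (v, w) \<in> parcs G then 1 else 0)"
proof -
  define n where "n = card (pverts G)"
  define vs where "vs = vertex_enum G"
  have "\<exists>vs. distinct vs \<and> set vs = pverts G"
    using finite_distinct_list[OF pair_finite_verts] by blast
  hence vs: "distinct vs" "set vs = pverts G"
    unfolding vs_def vertex_enum_def by (metis (mono_tags, lifting) someI_ex)+
  have len: "length vs = n" using vs distinct_card n_def by metis
  have bij: "bij_betw ((!) vs) {..<n} (pverts G)"
    using bij_betw_nth[OF vs(1), of "{..<n}" "pverts G"] vs len by simp
  define A where "A = adjacency_matrix G"
  have Aij: "A $$ (a, b) = (if (vs ! a, vs ! b) \<in> parcs G then 1 else 0)" if "a < n" "b < n" for a b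
    using that by (auto simp: A_def adjacency_matrix_def Let_def n_def vs_def)
  have A: "A \<in> carrier_mat n n" by (simp add: A_def adjacency_matrix_def Let_def n_def)
  have "transpose_mat A = A"
    using A Aij arcs_symmetric by (intro eq_matI) auto
  from real_spectral_theorem[OF A this] obtain Q d where Q: "Q \<in> carrier_mat n n"
    "transpose_mat Q * Q = 1\<^sub>m n" and AQ: "A = Q * mat n n (\<lambda>(i, j). if i = j then d i else 0) * transpose_mat Q"
    by blast
  let ?D = "mat n n (\<lambda>(i, j). if i = j then d i else 0) :: real mat"
  have QQ: "Q * transpose_mat Q = 1\<^sub>m n"
    using mat_mult_left_right_inverse[OF _ Q(1) Q(2)] Q(1) by simp
  have "similar_mat A ?D"
    by (rule similar_matI[of _ _ Q "transpose_mat Q" n]) (use A Q QQ AQ in auto)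
  hence "char_poly A = char_poly ?D" by (rule char_poly_similar)
  also have "\<dots> = (\<Prod>a\<leftarrow>diag_mat ?D. [:- a, 1:])"
    by (rule char_poly_upper_triangular[of _ n]) (auto simp: upper_triangular_def)
  also have "diag_mat ?D = map d [0..<n]" by (auto simp: diag_mat_def)
  finally have cp: "char_poly A = (\<Prod>a\<leftarrow>map d [0..<n]. [:- a, 1:])" .
  have "proots (\<Prod>a\<leftarrow>xs. [:- a, 1:]) = mset xs" for xs :: "real list"
  proof (induction xs)
    case (Cons a xs)
    have "(\<Prod>a\<leftarrow>xs. [:- a, 1:]) \<noteq> 0" by (auto simp: prod_list_zero_iff)
    hence "proots ([:- a, 1:] * (\<Prod>a\<leftarrow>xs. [:- a, 1:])) = {#a#} + mset xs"
      by (subst proots_mult) (simp_all del: mult_pCons_left add: Cons.IH)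
    thus ?case by simp
  qed simp
  hence "proots (char_poly A) = mset (map d [0..<n])" unfolding cp .
  hence "mset (spectrum_list G) = mset (map d [0..<n])"
    by (simp add: spectrum_list_def A_def[symmetric])
  \<comment> \<open>The spectral theorem returns the eigenvalues in no particular order.
    \<open>p\<close> matches them with the sorted \<open>spectrum_list\<close>, and the columns of
    \<open>Q\<close> are permuted along with them.\<close>
  from mset_eq_permutation[OF this] obtain p where
    p: "p permutes {..<n}" "permute_list p (map d [0..<n]) = spectrum_list G" by auto
  have len_s: "length (spectrum_list G) = n" unfolding p(2)[symmetric] by simp
  have pn: "p i < n" if "i < n" for i using p(1) that permutes_in_image by fastforce
  have sp: "spectrum_list G ! i = d (p i)" if "i < n" for i
    unfolding p(2)[symmetric] using that p(1) pn by (simp add: permute_list_nth)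
  define U where "U i v = Q $$ (the_inv_into {..<n} ((!) vs) v, p i)" for i v
  have U: "U i (vs ! a) = Q $$ (a, p i)" if "a < n" for i a
    unfolding U_def using that bij by (subst the_inv_into_f_f) (auto simp: bij_betw_def)
  have ex: "\<exists>a<n. vs ! a = v" if "v \<in> pverts G" for v
    using that vs len by (metis in_set_conv_nth)
  have psum: "(\<Sum>i<n. F (p i)) = (\<Sum>i<n. F i)" for F :: "nat \<Rightarrow> real"
    using sum.reindex_bij_betw[OF permutes_imp_bij[OF p(1)]] .
  have inj: "vs ! a = vs ! b \<longleftrightarrow> a = b" if "a < n" "b < n" for a b
    using that vs(1) len by (simp add: nth_eq_iff_index_eq)
  show ?thesis
  proof (rule that[of U])
    show "length (spectrum_list G) = card (pverts G)" using len_s n_def by simp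
  next
    fix i j assume "i < card (pverts G)" "j < card (pverts G)"
    hence ij: "i < n" "j < n" by (auto simp: n_def)
    have "(\<Sum>v\<in>pverts G. U i v * U j v) = (\<Sum>a<n. U i (vs ! a) * U j (vs ! a))"
      by (rule sum.reindex_bij_betw[OF bij, symmetric])
    also have "\<dots> = (\<Sum>a<n. Q $$ (a, p i) * Q $$ (a, p j))" using U by (intro sum.cong) auto
    also have "\<dots> = (transpose_mat Q * Q) $$ (p i, p j)"
      using Q(1) pn ij by (simp add: scalar_prod_def atLeast0LessThan)
    also have "\<dots> = (if i = j then 1 else 0)"
      unfolding Q(2) using pn ij permutes_inj[OF p(1)] by (auto dest: injD)
    finally show "(\<Sum>v\<in>pverts G. U i v * U j v) = (if i = j then 1 else 0)" .
  next
    fix v w assume "v \<in> pverts G" "w \<in> pverts G"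
    then obtain a b where ab: "a < n" "b < n" "v = vs ! a" "w = vs ! b" using ex by metis
    have "(\<Sum>i<n. U i v * U i w) = (\<Sum>i<n. Q $$ (a, i) * Q $$ (b, i))"
      unfolding ab(3,4) using U ab(1,2) psum[of "\<lambda>i. Q $$ (a, i) * Q $$ (b, i)"] by simp
    also have "\<dots> = (Q * transpose_mat Q) $$ (a, b)"
      using Q(1) ab by (simp add: scalar_prod_def atLeast0LessThan)
    finally show "(\<Sum>i<card (pverts G). U i v * U i w) = (if v = w then 1 else 0)"
      unfolding QQ using ab inj by (simp add: n_def)
    have "(\<Sum>i<n. spectrum_list G ! i * (U i v * U i w)) = (\<Sum>i<n. d (p i) * (Q $$ (a, p i) * Q $$ (b, p i)))"
      unfolding ab(3,4) using U ab(1,2) sp by simp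
    also have "\<dots> = (\<Sum>i<n. d i * (Q $$ (a, i) * Q $$ (b, i)))"
      by (rule psum)
    also have "\<dots> = (\<Sum>i<n. (Q * ?D) $$ (a, i) * Q $$ (b, i))"
    proof (rule sum.cong)
      fix i assume "i \<in> {..<n}"
      hence "(Q * ?D) $$ (a, i) = (\<Sum>k<n. Q $$ (a, k) * (if k = i then d k else 0))"
        using ab Q(1) by (simp add: scalar_prod_def atLeast0LessThan)
      also have "\<dots> = (\<Sum>k<n. if k = i then Q $$ (a, i) * d i else 0)"
        by (intro sum.cong) auto
      finally show "d i * (Q $$ (a, i) * Q $$ (b, i)) = (Q * ?D) $$ (a, i) * Q $$ (b, i)"
        using \<open>i \<in> {..<n}\<close> by simp
    qed simp
    also have "\<dots> = A $$ (a, b)"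
      using Q(1) ab by (subst AQ) (simp add: scalar_prod_def atLeast0LessThan)
    finally show "(\<Sum>i<card (pverts G). spectrum_list G ! i * (U i v * U i w)) = (if (v, w) \<in> parcs G then 1 else 0)"
      using ab Aij by (simp add: n_def)
  qed
qed

lemma quad_form_alt:
  "quad_form G f = (\<Sum>v\<in>pverts G. \<Sum>w\<in>pverts G. (if (v, w) \<in> parcs G then 1 else 0) * (f v * f w))"
proof -
  have sub: "parcs G \<subseteq> pverts G \<times> pverts G" using in_arcsD1 in_arcsD2 by auto
  have "quad_form G f = (\<Sum>e\<in>pverts G \<times> pverts G. if e \<in> parcs G then f (fst e) * f (snd e) else 0)"
    unfolding quad_form_def case_prod_unfold using sub pair_finite_verts
    by (intro sum.mono_neutral_cong_left) auto
  also have "\<dots> = (\<Sum>v\<in>pverts G. \<Sum>w\<in>pverts G. (if (v, w) \<in> parcs G then f v * f w else 0))"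
    unfolding sum.cartesian_product by (simp add: case_prod_unfold)
  finally show ?thesis by (simp add: if_distrib[of "\<lambda>x. x * _"] cong: if_cong)
qed

lemma spectrum_list_antimono:
  assumes "i \<le> j" "j < card (pverts G)" "length (spectrum_list G) = card (pverts G)"
  shows "spectrum_list G ! j \<le> spectrum_list G ! i"
proof -
  let ?l = "sorted_list_of_multiset (proots (char_poly (adjacency_matrix G)))"
  have "sorted (rev (spectrum_list G))" unfolding spectrum_list_def by simp
  thus ?thesis using assms by (intro sorted_rev_nth_mono) auto
qed

lemma eigenvalue_sum_eq: "eigenvalue_sum k G = (\<Sum>i<k. spectrum_list G ! i)"
  unfolding eigenvalue_sum_def graph_eigenvalue_def
  by (rule sum.reindex_bij_witness[of _ "\<lambda>i. Suc i" "\<lambda>i. i - 1"]) auto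

text \<open>With the weights \<open>c i = \<Sum>j. \<langle>x j, U i\<rangle>\<^sup>2\<close>, which lie in \<open>[0, 1]\<close>
  by Bessel's inequality and add up to \<open>k\<close>, the left-hand side is \<open>\<Sum>i. \<lambda> i * c i\<close>.\<close>

theorem ky_fan:
  fixes x :: "nat \<Rightarrow> 'a \<Rightarrow> real"
  assumes ortho: "\<And>i j. i < k \<Longrightarrow> j < k \<Longrightarrow> (\<Sum>v\<in>pverts G. x i v * x j v) = (if i = j then 1 else 0)"
    and k: "k \<le> card (pverts G)"
  shows "(\<Sum>j<k. quad_form G (x j)) \<le> eigenvalue_sum k G"
proof -
  obtain U where len: "length (spectrum_list G) = card (pverts G)"
    and U1: "\<And>i j. i < card (pverts G) \<Longrightarrow> j < card (pverts G) \<Longrightarrow>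
      (\<Sum>v\<in>pverts G. U i v * U j v) = (if i = j then 1 else 0)"
    and U2: "\<And>v w. v \<in> pverts G \<Longrightarrow> w \<in> pverts G \<Longrightarrow>
      (\<Sum>i<card (pverts G). U i v * U i w) = (if v = w then 1 else 0)"
    and U3: "\<And>v w. v \<in> pverts G \<Longrightarrow> w \<in> pverts G \<Longrightarrow>
      (\<Sum>i<card (pverts G). spectrum_list G ! i * (U i v * U i w)) = (if (v, w) \<in> parcs G then 1 else 0)"
    using orthonormal_eigenbasis by blast
  define n where "n = card (pverts G)"
  define l where "l = (!) (spectrum_list G)"
  let ?V = "pverts G"
  define c where "c i j = (\<Sum>v\<in>?V. x j v * U i v)" for i j
  have sq: "(\<Sum>v\<in>?V. f v * U i v)\<^sup>2 = (\<Sum>v\<in>?V. \<Sum>w\<in>?V. f v * f w * (U i v * U i w))" for f i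
    unfolding power2_eq_square sum_product by (intro sum.cong) auto
  have form: "quad_form G f = (\<Sum>i<n. l i * (\<Sum>v\<in>?V. f v * U i v)\<^sup>2)" for f
  proof -
    have "quad_form G f = (\<Sum>v\<in>?V. \<Sum>w\<in>?V. \<Sum>i<n. l i * (U i v * U i w) * (f v * f w))"
      unfolding quad_form_alt sum_distrib_right[symmetric] using U3 by (simp add: n_def l_def)
    also have "\<dots> = (\<Sum>v\<in>?V. \<Sum>i<n. \<Sum>w\<in>?V. l i * (U i v * U i w) * (f v * f w))"
      by (intro sum.cong refl sum.swap)
    also have "\<dots> = (\<Sum>i<n. \<Sum>v\<in>?V. \<Sum>w\<in>?V. l i * (U i v * U i w) * (f v * f w))"
      by (rule sum.swap)
    also have "\<dots> = (\<Sum>i<n. l i * (\<Sum>v\<in>?V. f v * U i v)\<^sup>2)"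
      unfolding sq sum_distrib_left by (intro sum.cong) auto
    finally show ?thesis .
  qed
  have parseval: "(\<Sum>i<n. (c i j)\<^sup>2) = 1" if "j < k" for j
  proof -
    have "(\<Sum>i<n. (c i j)\<^sup>2) = (\<Sum>i<n. \<Sum>v\<in>?V. \<Sum>w\<in>?V. x j v * x j w * (U i v * U i w))"
      unfolding c_def sq ..
    also have "\<dots> = (\<Sum>v\<in>?V. \<Sum>i<n. \<Sum>w\<in>?V. x j v * x j w * (U i v * U i w))"
      by (rule sum.swap)
    also have "\<dots> = (\<Sum>v\<in>?V. \<Sum>w\<in>?V. x j v * x j w * (\<Sum>i<n. U i v * U i w))"
      unfolding sum_distrib_left by (intro sum.cong refl sum.swap)
    also have "\<dots> = (\<Sum>v\<in>?V. \<Sum>w\<in>?V. if w = v then x j v * x j w else 0)"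
      using U2 by (intro sum.cong) (auto simp: n_def)
    also have "\<dots> = (\<Sum>v\<in>?V. x j v * x j v)"
      using pair_finite_verts by simp
    finally show ?thesis using ortho[OF that that] by simp
  qed
  define s where "s i = (\<Sum>j<k. (c i j)\<^sup>2)" for i
  have s0: "s i \<ge> 0" for i unfolding s_def by (intro sum_nonneg) auto
  have s1: "s i \<le> 1" if "i < n" for i
  proof -
    \<comment> \<open>\<open>r\<close> is what remains of \<open>U i\<close> after projection to the
      span of the \<open>x j\<close>; its squared norm \<open>1 - s i\<close> is nonnegative, which
      is Bessel's inequality.\<close>
    define r where "r v = U i v - (\<Sum>j<k. c i j * x j v)" for v
    have a: "(\<Sum>v\<in>?V. U i v * (\<Sum>j<k. c i j * x j v)) = s i"
    proof -
      have "(\<Sum>v\<in>?V. U i v * (\<Sum>j<k. c i j * x j v)) = (\<Sum>j<k. \<Sum>v\<in>?V. c i j * (x j v * U i v))"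
        unfolding sum_distrib_left by (subst sum.swap) (intro sum.cong, auto)
      thus ?thesis unfolding s_def by (simp add: sum_distrib_left[symmetric] c_def power2_eq_square)
    qed
    have b: "(\<Sum>v\<in>?V. (\<Sum>j<k. c i j * x j v) * (\<Sum>j<k. c i j * x j v)) = s i"
    proof -
      have "(\<Sum>v\<in>?V. (\<Sum>j<k. c i j * x j v) * (\<Sum>j<k. c i j * x j v))
         = (\<Sum>v\<in>?V. \<Sum>j<k. \<Sum>j'<k. c i j * c i j' * (x j v * x j' v))"
        unfolding sum_product by (intro sum.cong) auto
      also have "\<dots> = (\<Sum>j<k. \<Sum>v\<in>?V. \<Sum>j'<k. c i j * c i j' * (x j v * x j' v))"
        by (rule sum.swap)
      also have "\<dots> = (\<Sum>j<k. \<Sum>j'<k. c i j * c i j' * (\<Sum>v\<in>?V. x j v * x j' v))"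
        unfolding sum_distrib_left by (intro sum.cong refl sum.swap)
      also have "\<dots> = (\<Sum>j<k. \<Sum>j'<k. if j' = j then c i j * c i j' else 0)"
        using ortho by (intro sum.cong) auto
      finally show ?thesis by (simp add: s_def power2_eq_square)
    qed
    have "0 \<le> (\<Sum>v\<in>?V. (r v)\<^sup>2)" by (intro sum_nonneg) auto
    also have "\<dots> = (\<Sum>v\<in>?V. U i v * U i v) - 2 * (\<Sum>v\<in>?V. U i v * (\<Sum>j<k. c i j * x j v))
        + (\<Sum>v\<in>?V. (\<Sum>j<k. c i j * x j v) * (\<Sum>j<k. c i j * x j v))"
      unfolding r_def power2_diff sum.distrib sum_subtractf
      by (simp add: power2_eq_square sum_distrib_left mult.assoc)
    also have "\<dots> = 1 - s i" unfolding a b using U1[of i i] that by (simp add: n_def)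
    finally show ?thesis by simp
  qed
  have ssum: "(\<Sum>i<n. s i) = real k"
    unfolding s_def by (subst sum.swap) (simp add: parseval)
  have split: "(\<Sum>i<n. F i) = (\<Sum>i<k. F i) + (\<Sum>i=k..<n. F i)" for F :: "nat \<Rightarrow> real"
    using k n_def sum.atLeastLessThan_concat[of 0 k n F] by (simp add: atLeast0LessThan)
  have "(\<Sum>j<k. quad_form G (x j)) = (\<Sum>j<k. \<Sum>i<n. l i * (c i j)\<^sup>2)"
    unfolding form c_def ..
  also have "\<dots> = (\<Sum>i<n. l i * s i)"
    unfolding s_def sum_distrib_left by (rule sum.swap)
  also have "\<dots> \<le> (\<Sum>i<k. l i)"
  \<comment> \<open>For \<open>k = n\<close> there is no eigenvalue \<open>l k\<close> to serve as a
    threshold; but then the weights, at most 1 and with sum \<open>n\<close>, are all equal to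
    1.\<close>
  proof (cases "k = n")
    case True
    have "(\<Sum>i<n. 1 - s i) = 0" using ssum True by (simp add: sum_subtractf)
    hence "\<forall>i\<in>{..<n}. 1 - s i = 0" using s1 by (subst (asm) sum_nonneg_eq_0_iff) auto
    thus ?thesis using True by simp
  next
    case False
    hence kn: "k < n" using k n_def by simp
    \<comment> \<open>Weight is moved across the threshold \<open>m\<close>: for
      \<open>i < k\<close> the product \<open>(l i - m) * (1 - s i)\<close> is nonnegative, for
      \<open>i >= k\<close> one has \<open>l i <= m\<close>. Since the weights add up to
      \<open>k\<close>, the terms in \<open>m\<close> cancel.\<close>
    define m where "m = l k"
    have lo: "l i \<le> m" if "i \<ge> k" "i < n" for i
      unfolding m_def l_def using spectrum_list_antimono[OF that(1) _ len] that n_def by simp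
    have hi: "m \<le> l i" if "i < k" for i
      unfolding m_def l_def using spectrum_list_antimono[OF _ _ len, of i k] that kn n_def by simp
    have "(\<Sum>i<n. l i * s i) = (\<Sum>i<k. l i * s i) + (\<Sum>i=k..<n. l i * s i)" by (rule split)
    also have "\<dots> \<le> (\<Sum>i<k. l i + m * s i - m) + (\<Sum>i=k..<n. m * s i)"
    proof (intro add_mono sum_mono)
      fix i assume "i \<in> {..<k}"
      hence "(l i - m) * (1 - s i) \<ge> 0" using hi s1 kn by (intro mult_nonneg_nonneg) auto
      thus "l i * s i \<le> l i + m * s i - m" by (simp add: algebra_simps)
    next
      fix i assume "i \<in> {k..<n}"
      thus "l i * s i \<le> m * s i" using lo s0 by (intro mult_right_mono) auto
    qed
    also have "\<dots> = (\<Sum>i<k. l i) + m * ((\<Sum>i<k. s i) + (\<Sum>i=k..<n. s i)) - k * m"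
      by (simp add: sum.distrib sum_subtractf sum_distrib_left algebra_simps)
    also have "\<dots> = (\<Sum>i<k. l i)" unfolding split[symmetric] ssum by simp
    finally show ?thesis .
  qed
  also have "\<dots> = eigenvalue_sum k G" unfolding eigenvalue_sum_eq l_def ..
  finally show ?thesis .
qed

end

section \<open>Positive supersolutions\<close>

definition neighbours :: "'a pair_pre_digraph \<Rightarrow> 'a \<Rightarrow> 'a set" where
  "neighbours G v = {w. (v, w) \<in> parcs G}"

context pair_graph
begin

lemma neighbours_subset: "neighbours G v \<subseteq> pverts G"
  using in_arcsD2 by (auto simp: neighbours_def)

lemma finite_neighbours [simp]: "finite (neighbours G v)"
  using finite_subset[OF neighbours_subset pair_finite_verts] .

lemma neighbours_sym: "w \<in> neighbours G v \<longleftrightarrow> v \<in> neighbours G w"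
  using arcs_symmetric by (auto simp: neighbours_def)

lemma not_neighbour_self: "v \<notin> neighbours G v"
  using pair_no_loops by (force simp: neighbours_def)

text \<open>Connectedness enters the proof only in this form. The closed sets are the maximisers of
  \<open>|f| / h\<close>, the vertices reachable from \<open>u\<close>, and a longest path together
  with the vertices attached to it.\<close>

lemma connected_closed_eq:
  assumes con: "Digraph_Component.connected (with_proj G)"
    and S: "S \<subseteq> pverts G" "S \<noteq> {}" and closed: "\<And>v. v \<in> S \<Longrightarrow> neighbours G v \<subseteq> S"
  shows "S = pverts G"
proof -
  have "v \<in> S" if u: "u \<in> S" and uv: "(u, v) \<in> rtrancl_on (pverts G) ((parcs G)\<^sup>s)" for u v
    using uv u
  proof (induction rule: rtrancl_on_induct)
    case (step x y)
    hence "(x, y) \<in> parcs G" using arcs_symmetric by (auto simp: symcl_def)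
    thus ?case using closed step by (auto simp: neighbours_def)
  qed simp
  thus ?thesis using con S unfolding connected_conv by auto
qed

text \<open>Maximum principle: the vertices at which \<open>\<bar>f\<bar> / h\<close> is maximal form a set that is closed
  under taking neighbours.\<close>

lemma eigenvector_supersolution:
  fixes f h :: "'a \<Rightarrow> real"
  assumes con: "Digraph_Component.connected (with_proj G)"
    and h0: "\<And>v. v \<in> pverts G \<Longrightarrow> h v > 0"
    and h: "\<And>v. v \<in> pverts G \<Longrightarrow> (\<Sum>w\<in>neighbours G v. h w) \<le> 2 * h v"
    and f: "\<And>v. v \<in> pverts G \<Longrightarrow> (\<Sum>w\<in>neighbours G v. f w) = l * f v"
    and u: "u \<in> pverts G" "f u \<noteq> 0" and l: "l \<ge> (2::real)"
  shows "l = 2" and "\<forall>v\<in>pverts G. f v \<noteq> 0"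
proof -
  define M where "M = Max ((\<lambda>v. \<bar>f v\<bar> / h v) ` pverts G)"
  have fin: "finite ((\<lambda>v. \<bar>f v\<bar> / h v) ` pverts G)" using pair_finite_verts by simp
  have le: "\<bar>f v\<bar> \<le> M * h v" if "v \<in> pverts G" for v
  proof -
    have "\<bar>f v\<bar> / h v \<le> M" unfolding M_def using that fin by (intro Max_ge) auto
    thus ?thesis using h0[OF that] by (simp add: divide_le_eq)
  qed
  have "M * h u > 0" using le[OF u(1)] u(2) by simp
  hence M: "M > 0" using h0[OF u(1)] by (simp add: zero_less_mult_iff)
  have "M \<in> (\<lambda>v. \<bar>f v\<bar> / h v) ` pverts G"
    unfolding M_def using fin u by (intro Max_in) auto
  then obtain m where m: "m \<in> pverts G" "\<bar>f m\<bar> = M * h m" using h0 by (force simp: field_simps)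
  define S where "S = {v \<in> pverts G. \<bar>f v\<bar> = M * h v}"
  \<comment> \<open>\<open>l |f v| <= sum |f w| <= M * sum h w <= 2 M h v = 2 |f v|\<close>, so
    \<open>l >= 2\<close> forces equality throughout: \<open>l = 2\<close>, and
    \<open>|f w| = M * h w\<close> at every neighbour.\<close>
  have key: "l = 2 \<and> neighbours G v \<subseteq> S" if v: "v \<in> S" for v
  proof -
    have vV: "v \<in> pverts G" and fv: "\<bar>f v\<bar> = M * h v" using v by (auto simp: S_def)
    have pos: "\<bar>f v\<bar> > 0" using fv M h0[OF vV] by simp
    have "l * \<bar>f v\<bar> = \<bar>\<Sum>w\<in>neighbours G v. f w\<bar>" using f[OF vV] l by (simp add: abs_mult)
    also have "\<dots> \<le> (\<Sum>w\<in>neighbours G v. \<bar>f w\<bar>)" by (rule sum_abs)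
    finally have 1: "l * \<bar>f v\<bar> \<le> (\<Sum>w\<in>neighbours G v. \<bar>f w\<bar>)" .
    have 2: "(\<Sum>w\<in>neighbours G v. \<bar>f w\<bar>) \<le> (\<Sum>w\<in>neighbours G v. M * h w)"
      using le neighbours_subset by (intro sum_mono) blast
    have "(\<Sum>w\<in>neighbours G v. M * h w) \<le> M * (2 * h v)"
      unfolding sum_distrib_left[symmetric] using h[OF vV] M by (intro mult_left_mono) auto
    hence 3: "(\<Sum>w\<in>neighbours G v. M * h w) \<le> 2 * \<bar>f v\<bar>" using fv by simp
    have "l * \<bar>f v\<bar> \<le> 2 * \<bar>f v\<bar>" using 1 2 3 by linarith
    hence l2: "l = 2" using pos l by simp
    have "(\<Sum>w\<in>neighbours G v. M * h w - \<bar>f w\<bar>) \<le> 0"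
      using 1 3 l2 by (simp add: sum_subtractf)
    moreover have nn: "\<forall>w\<in>neighbours G v. M * h w - \<bar>f w\<bar> \<ge> 0" using le neighbours_subset by force
    ultimately have "(\<Sum>w\<in>neighbours G v. M * h w - \<bar>f w\<bar>) = 0"
      using sum_nonneg[of "neighbours G v" "\<lambda>w. M * h w - \<bar>f w\<bar>"] by force
    hence "\<forall>w\<in>neighbours G v. M * h w - \<bar>f w\<bar> = 0"
      using nn by (subst (asm) sum_nonneg_eq_0_iff) auto
    thus ?thesis using l2 neighbours_subset by (force simp: S_def)
  qed
  have "S = pverts G"
    by (rule connected_closed_eq[OF con]) (use m key in \<open>auto simp: S_def\<close>)
  thus "\<forall>v\<in>pverts G. f v \<noteq> 0" using M h0 by (force simp: S_def)
  show "l = 2" using key[of m] m by (simp add: S_def)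
qed

text \<open>Every eigenvalue is at most 2, so one eigenvalue below 2 among the first
  \<open>k\<close> gives the strict inequality. The largest may equal 2; hence
  \<open>l 1 < 2\<close> is shown for the second, and \<open>k >= 2\<close> makes it count.\<close>

lemma eigenvalue_sum_less_supersolution:
  fixes h :: "'a \<Rightarrow> real"
  assumes con: "Digraph_Component.connected (with_proj G)"
    and h0: "\<And>v. v \<in> pverts G \<Longrightarrow> h v > 0"
    and h: "\<And>v. v \<in> pverts G \<Longrightarrow> (\<Sum>w\<in>neighbours G v. h w) \<le> 2 * h v"
    and k: "2 \<le> k" "k \<le> card (pverts G)"
  shows "eigenvalue_sum k G < 2 * real k"
proof -
  obtain U where len: "length (spectrum_list G) = card (pverts G)"
    and U1: "\<And>i j. i < card (pverts G) \<Longrightarrow> j < card (pverts G) \<Longrightarrow>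
      (\<Sum>v\<in>pverts G. U i v * U j v) = (if i = j then 1 else 0)"
    and U2: "\<And>v w. v \<in> pverts G \<Longrightarrow> w \<in> pverts G \<Longrightarrow>
      (\<Sum>i<card (pverts G). U i v * U i w) = (if v = w then 1 else 0)"
    and U3: "\<And>v w. v \<in> pverts G \<Longrightarrow> w \<in> pverts G \<Longrightarrow>
      (\<Sum>i<card (pverts G). spectrum_list G ! i * (U i v * U i w)) = (if (v, w) \<in> parcs G then 1 else 0)"
    using orthonormal_eigenbasis by blast
  define n where "n = card (pverts G)"
  define l where "l = (!) (spectrum_list G)"
  let ?V = "pverts G"
  \<comment> \<open>The eigenvector equation is recovered from the spectral decomposition by pairing
    it with \<open>U j\<close>.\<close>
  have eig: "(\<Sum>w\<in>neighbours G v. U j w) = l j * U j v" if v: "v \<in> ?V" and j: "j < n" for j v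
  proof -
    have "(\<Sum>w\<in>neighbours G v. U j w) = (\<Sum>w\<in>?V. (if (v, w) \<in> parcs G then 1 else 0) * U j w)"
      using neighbours_subset pair_finite_verts
      by (intro sum.mono_neutral_cong_left) (auto simp: neighbours_def)
    also have "\<dots> = (\<Sum>w\<in>?V. \<Sum>i<n. l i * U i v * (U i w * U j w))"
    proof (rule sum.cong)
      fix w assume w: "w \<in> ?V"
      show "(if (v, w) \<in> parcs G then 1 else 0) * U j w = (\<Sum>i<n. l i * U i v * (U i w * U j w))"
        unfolding U3[OF v w, symmetric] l_def n_def sum_distrib_right by (simp add: mult_ac)
    qed simp
    also have "\<dots> = (\<Sum>i<n. l i * U i v * (\<Sum>w\<in>?V. U i w * U j w))"
      unfolding sum_distrib_left by (rule sum.swap)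
    also have "\<dots> = (\<Sum>i<n. if i = j then l i * U i v else 0)"
      using U1 j by (intro sum.cong) (auto simp: n_def)
    finally show ?thesis using j by simp
  qed
  have nz: "\<exists>v\<in>?V. U j v \<noteq> 0" if "j < n" for j
  proof (rule ccontr)
    assume "\<not> (\<exists>v\<in>?V. U j v \<noteq> 0)"
    hence "(\<Sum>v\<in>?V. U j v * U j v) = 0" by simp
    thus False using U1[of j j] that by (simp add: n_def)
  qed
  have le2: "l j \<le> 2" if j: "j < n" for j
    using eigenvector_supersolution(1)[OF con h0 h eig[OF _ j]] nz[OF j] by force
  have l1: "l 1 < 2"
  proof (rule ccontr)
    assume "\<not> l 1 < 2"
    hence l1: "l 1 = 2" using le2[of 1] k n_def by simp
    moreover have "l 1 \<le> l 0" using spectrum_list_antimono[OF _ _ len, of 0 1] k by (simp add: l_def)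
    ultimately have l0: "l 0 = 2" using le2[of 0] k n_def by simp
    have n: "0 < n" "1 < n" using k n_def by auto
    obtain x where x: "x \<in> ?V" using nz[OF n(1)] by blast
    have nonvan: "F v \<noteq> 0" if "\<And>v. v \<in> ?V \<Longrightarrow> (\<Sum>w\<in>neighbours G v. F w) = 2 * F v"
      "u \<in> ?V" "F u \<noteq> 0" "v \<in> ?V" for F :: "'a \<Rightarrow> real" and u v
      using eigenvector_supersolution(2)[OF con h0 h that(1-3)] that(4) by simp
    obtain y where y: "y \<in> ?V" "U 0 y \<noteq> 0" using nz[OF n(1)] by blast
    have non0: "U 0 x \<noteq> 0"
      by (rule nonvan[of "U 0", OF _ y x]) (simp add: eig[OF _ n(1)] l0)
    define f where "f v = U 0 x * U 1 v - U 1 x * U 0 v" for v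
    have "(\<Sum>w\<in>neighbours G v. f w) = 2 * f v" if "v \<in> ?V" for v
    proof -
      have "(\<Sum>w\<in>neighbours G v. f w) = U 0 x * (\<Sum>w\<in>neighbours G v. U 1 w) - U 1 x * (\<Sum>w\<in>neighbours G v. U 0 w)"
        by (simp add: f_def sum_subtractf sum_distrib_left)
      thus ?thesis unfolding eig[OF that n(1)] eig[OF that n(2)] l0 l1 by (simp add: f_def)
    qed
    hence f0: "f v = 0" if "v \<in> ?V" for v
      using nonvan[of f v x] x that by (auto simp: f_def)
    have "0 = (\<Sum>v\<in>?V. f v * U 1 v)" using f0 by simp
    also have "\<dots> = U 0 x * (\<Sum>v\<in>?V. U 1 v * U 1 v) - U 1 x * (\<Sum>v\<in>?V. U 0 v * U 1 v)"
      by (simp add: f_def sum_distrib_left sum_subtractf algebra_simps)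
    also have "\<dots> = U 0 x" using U1[of 1 1] U1[of 0 1] n by (simp add: n_def)
    finally show False using non0 by simp
  qed
  have "(\<Sum>i<k. l i) < (\<Sum>i<k. 2)"
  proof (rule sum_strict_mono_ex1)
    show "\<forall>i\<in>{..<k}. l i \<le> 2" using le2 k n_def by auto
    show "\<exists>i\<in>{..<k}. l i < 2" using l1 k by (intro bexI[of _ 1]) auto
  qed simp
  thus ?thesis unfolding eigenvalue_sum_eq l_def by simp
qed

section \<open>Isomorphisms of graphs\<close>

lemma graph_isoI:
  assumes bij: "bij_betw f (pverts G) (pverts H)" and H: "parcs H \<subseteq> pverts H \<times> pverts H"
    and arcs: "\<And>u v. u \<in> pverts G \<Longrightarrow> v \<in> pverts G \<Longrightarrow> (u, v) \<in> parcs G \<longleftrightarrow> (f u, f v) \<in> parcs H"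
  shows "graph_iso G H"
proof -
  let ?h = "\<lparr>iso_verts = f, iso_arcs = map_prod f f, iso_head = snd, iso_tail = fst\<rparr>"
  have inj: "inj_on f (pverts G)" and img: "f ` pverts G = pverts H"
    using bij by (auto simp: bij_betw_def)
  have sub: "parcs G \<subseteq> pverts G \<times> pverts G" using in_arcsD1 in_arcsD2 by auto
  have "inj_on (map_prod f f) (parcs G)"
    by (rule inj_on_subset[OF map_prod_inj_on[OF inj inj] sub])
  hence "pre_digraph.digraph_isomorphism (with_proj G) ?h"
    unfolding pre_digraph.digraph_isomorphism_def using inj wf_digraph_axioms by simp
  moreover have "parcs H \<subseteq> map_prod f f ` parcs G"
  proof (rule subrelI)
    fix a b assume ab: "(a, b) \<in> parcs H"
    then obtain u v where uv: "u \<in> pverts G" "v \<in> pverts G" "a = f u" "b = f v"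
      using H img by blast
    hence "(u, v) \<in> parcs G" using arcs ab by simp
    thus "(a, b) \<in> map_prod f f ` parcs G" using uv by force
  qed
  hence "map_prod f f ` parcs G = parcs H" using arcs sub by auto
  hence "with_proj H = app_iso ?h (with_proj G)"
    unfolding app_iso_def with_proj_def using img by simp
  ultimately show ?thesis unfolding graph_iso_def digraph_iso_def by blast
qed

lemma graph_isoE:
  assumes "graph_iso G H"
  obtains f where "bij_betw f (pverts G) (pverts H)" "\<And>u v. (u, v) \<in> parcs G \<Longrightarrow> (f u, f v) \<in> parcs H"
proof -
  obtain h where h: "pre_digraph.digraph_isomorphism (with_proj G) h" "with_proj H = app_iso h (with_proj G)"
    using assms unfolding graph_iso_def digraph_iso_def by blast
  have H: "pverts H = iso_verts h ` pverts G" "parcs H = iso_arcs h ` parcs G"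
     "iso_tail h = fst" "iso_head h = snd"
    using h(2) unfolding with_proj_def app_iso_def by auto
  have "bij_betw (iso_verts h) (pverts G) (pverts H)"
    using h(1) H(1) unfolding pre_digraph.digraph_isomorphism_def bij_betw_def by simp
  moreover have "(iso_verts h u, iso_verts h v) \<in> parcs H" if "(u, v) \<in> parcs G" for u v
  proof -
    have "iso_verts h u = fst (iso_arcs h (u, v))" "iso_verts h v = snd (iso_arcs h (u, v))"
      using h(1) that H(3,4) unfolding pre_digraph.digraph_isomorphism_def by force+
    thus ?thesis using that H(2) by (metis image_eqI prod.collapse)
  qed
  ultimately show ?thesis using that by blast
qed

text \<open>The spectrum is not carried over to \<open>H\<close>; the supersolution is pulled back
  to \<open>G\<close> instead. The isomorphism maps the neighbours of \<open>v\<close> injectively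
  into those of \<open>f v\<close>, and since \<open>h\<close> is positive any remaining neighbours
  can only enlarge the sum. The special graphs are plain records, hence the explicit assumptions on
  \<open>H\<close>.\<close>

lemma eigenvalue_sum_less_iso:
  fixes h :: "'b \<Rightarrow> real"
  assumes con: "Digraph_Component.connected (with_proj G)" and iso: "graph_iso G H"
    and k: "2 \<le> k" "k \<le> card (pverts G)"
    and h0: "\<And>v. v \<in> pverts H \<Longrightarrow> h v > 0"
    and finH: "\<And>v. v \<in> pverts H \<Longrightarrow> finite (neighbours H v) \<and> neighbours H v \<subseteq> pverts H"
    and h: "\<And>v. v \<in> pverts H \<Longrightarrow> (\<Sum>w\<in>neighbours H v. h w) \<le> 2 * h v"
  shows "eigenvalue_sum k G < 2 * real k"
proof -
  obtain f where f: "bij_betw f (pverts G) (pverts H)" "\<And>u v. (u, v) \<in> parcs G \<Longrightarrow> (f u, f v) \<in> parcs H"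
    using graph_isoE[OF iso] by blast
  have fV: "f v \<in> pverts H" if "v \<in> pverts G" for v using f(1) that bij_betwE by fastforce
  show ?thesis
  proof (rule eigenvalue_sum_less_supersolution[OF con _ _ k])
    fix v assume v: "v \<in> pverts G"
    show "h (f v) > 0" using h0 fV v by simp
    have inj: "inj_on f (neighbours G v)"
      using f(1) neighbours_subset by (auto simp: bij_betw_def intro: inj_on_subset)
    have "(\<Sum>w\<in>neighbours G v. h (f w)) = (\<Sum>w\<in>f ` neighbours G v. h w)"
      using sum.reindex[OF inj, of h] by simp
    also have "\<dots> \<le> (\<Sum>w\<in>neighbours H (f v). h w)"
    proof (rule sum_mono2)
      show "finite (neighbours H (f v))" using finH fV v by blast
      show "f ` neighbours G v \<subseteq> neighbours H (f v)" using f(2) by (auto simp: neighbours_def)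
      show "0 \<le> h b" if "b \<in> neighbours H (f v) - f ` neighbours G v" for b
        using that finH[OF fV[OF v]] h0 by force
    qed
    also have "\<dots> \<le> 2 * h (f v)" using h fV v by blast
    finally show "(\<Sum>w\<in>neighbours G v. h (f w)) \<le> 2 * h (f v)" .
  qed
qed

end

section \<open>The four exceptional graphs\<close>

lemmas special_graph_defs = P_graph_def C_graph_def Y_graph_def W_graph_def insert_edge_def delete_edge_def

text \<open>The neighbourhoods below are overestimated, by indices such as 0 or \<open>n + 1\<close>
  that are no vertices. For nonnegative weights a bound on the larger sum is enough.\<close>

lemma sum_le_sum_superset:
  fixes h :: "'b \<Rightarrow> real"
  assumes "A \<subseteq> B" "finite B" "\<And>b. h b \<ge> 0" "sum h B \<le> c"
  shows "sum h A \<le> c"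
  using sum_mono2[OF assms(2,1), of h] assms(3,4) by force

lemma insert_edge_arcs:
  "(i, j) \<in> parcs (insert_edge u v G) \<longleftrightarrow> (i, j) \<in> parcs G \<or> i = u \<and> j = v \<or> i = v \<and> j = u"
  by (auto simp: insert_edge_def)

lemma delete_edge_arcs:
  "(i, j) \<in> parcs (delete_edge u v G) \<longleftrightarrow> (i, j) \<in> parcs G \<and> \<not> (i = u \<and> j = v \<or> i = v \<and> j = u)"
  by (auto simp: delete_edge_def)

lemma P_graph_arcs: "(i, j) \<in> parcs (P_graph n) \<longleftrightarrow> i \<in> {1..n} \<and> j \<in> {1..n} \<and> (j = i + 1 \<or> i = j + 1)"
  by (simp add: P_graph_def)

lemma special_graph_arcs:
  "(i, j) \<in> parcs (C_graph n) \<longleftrightarrow> (i, j) \<in> parcs (P_graph n) \<or> i = n \<and> j = 1 \<or> i = 1 \<and> j = n"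
  "(i, j) \<in> parcs (Y_graph n) \<longleftrightarrow> (i, j) \<in> parcs (P_graph n) \<and> \<not> (i = 1 \<and> j = 2 \<or> i = 2 \<and> j = 1)
    \<or> i = 1 \<and> j = 3 \<or> i = 3 \<and> j = 1"
  "(i, j) \<in> parcs (W_graph n) \<longleftrightarrow> (i, j) \<in> parcs (P_graph n) \<and> \<not> (i = 1 \<and> j = 2 \<or> i = 2 \<and> j = 1)
    \<and> \<not> (i = n - 1 \<and> j = n \<or> i = n \<and> j = n - 1)
    \<or> i = 1 \<and> j = 3 \<or> i = 3 \<and> j = 1 \<or> i = n - 2 \<and> j = n \<or> i = n \<and> j = n - 2"
  unfolding C_graph_def Y_graph_def W_graph_def insert_edge_arcs delete_edge_arcs
  by blast+

lemma P_graph_neighbours: "neighbours (P_graph n) i \<subseteq> {i - 1, i + 1}"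
  by (auto simp: neighbours_def special_graph_arcs P_graph_arcs)

lemma C_graph_neighbours:
  "neighbours (C_graph n) i \<subseteq> (if i = 1 then {2, n} else if i = n then {n - 1, 1} else {i - 1, i + 1})"
  by (auto simp: neighbours_def special_graph_arcs P_graph_arcs)

lemma Y_graph_neighbours:
  "neighbours (Y_graph n) i \<subseteq> (if i \<le> 2 then {3} else if i = 3 then {1, 2, 4} else {i - 1, i + 1})"
proof
  fix j assume "j \<in> neighbours (Y_graph n) i"
  hence "i \<ge> 1 \<and> j \<ge> 1 \<and> (j = i + 1 \<or> i = j + 1) \<and> (i, j) \<noteq> (1, 2) \<and> (i, j) \<noteq> (2, 1) \<or> (i, j) = (1, 3) \<or> (i, j) = (3, 1)"
    by (auto simp: neighbours_def special_graph_arcs P_graph_arcs)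
  thus "j \<in> (if i \<le> 2 then {3} else if i = 3 then {1, 2, 4} else {i - 1, i + 1})"
    by (elim disjE) auto
qed

lemma W_graph_neighbours:
  assumes "n \<ge> 6"
  shows "neighbours (W_graph n) i \<subseteq> (if i \<le> 2 then {3} else if i = 3 then {1, 2, 4}
    else if i = n - 2 then {n - 3, n - 1, n} else if i \<ge> n - 1 then {n - 2} else {i - 1, i + 1})"
proof
  \<comment> \<open>Writing \<open>n\<close> as \<open>m + 6\<close> removes the truncated
    subtractions \<open>n - 1\<close> and \<open>n - 2\<close>.\<close>
  obtain m where m: "n = m + 6" using assms by (metis add.commute le_Suc_ex)
  fix j assume "j \<in> neighbours (W_graph n) i"
  hence "i \<ge> 1 \<and> j \<ge> 1 \<and> i \<le> m + 6 \<and> j \<le> m + 6 \<and> (j = i + 1 \<or> i = j + 1) \<and> (i, j) \<noteq> (1, 2) \<and> (i, j) \<noteq> (2, 1)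
      \<and> (i, j) \<noteq> (5 + m, m + 6) \<and> (i, j) \<noteq> (m + 6, 5 + m)
    \<or> (i, j) = (1, 3) \<or> (i, j) = (3, 1) \<or> (i, j) = (4 + m, m + 6) \<or> (i, j) = (m + 6, 4 + m)"
    by (simp add: neighbours_def special_graph_arcs P_graph_arcs m) blast
  thus "j \<in> (if i \<le> 2 then {3} else if i = 3 then {1, 2, 4}
    else if i = n - 2 then {n - 3, n - 1, n} else if i \<ge> n - 1 then {n - 2} else {i - 1, i + 1})"
    unfolding m by (elim disjE conjE) auto
qed

lemma special_graph_wf:
  assumes "n \<ge> 6" "H \<in> {P_graph n, C_graph n, Y_graph n, W_graph n}"
  shows "pverts H = {1..n}" "parcs H \<subseteq> pverts H \<times> pverts H"
  using assms by (auto simp: special_graph_defs)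

text \<open>On \<open>C_n\<close> and \<open>W_n\<close> equality holds at every vertex, so 2 is an
  eigenvalue there; up to a factor the weights are the marks of the affine diagrams of types A and
  D. On \<open>P_n\<close> and \<open>Y_n\<close> the inequality is strict at a free end.\<close>

lemma special_graph_supersolution:
  assumes n: "n \<ge> 6" and H: "H \<in> {P_graph n, C_graph n, Y_graph n, W_graph n}"
  shows "\<exists>h :: nat \<Rightarrow> real. (\<forall>v. h v > 0) \<and> (\<forall>v \<in> pverts H. (\<Sum>w\<in>neighbours H v. h w) \<le> 2 * h v)"
proof -
  define hY :: "nat \<Rightarrow> real" where "hY i = (if i \<le> 2 then 1/2 else 1)" for i
  define hW :: "nat \<Rightarrow> real" where "hW i = (if i \<le> 2 \<or> i \<ge> n - 1 then 1/2 else 1)" for i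
  have P: "(\<Sum>w\<in>neighbours (P_graph n) i. 1) \<le> (2::real)" if "i \<in> {1..n}" for i
    by (rule sum_le_sum_superset[OF P_graph_neighbours]) auto
  have C: "(\<Sum>w\<in>neighbours (C_graph n) i. 1) \<le> (2::real)" if "i \<in> {1..n}" for i
    by (rule sum_le_sum_superset[OF C_graph_neighbours])
       (use n in \<open>auto simp: card_insert_if\<close>)
  have Y: "(\<Sum>w\<in>neighbours (Y_graph n) i. hY w) \<le> 2 * hY i" if "i \<in> {1..n}" for i
    by (rule sum_le_sum_superset[OF Y_graph_neighbours])
       (use n in \<open>auto simp: hY_def\<close>)
  have W: "(\<Sum>w\<in>neighbours (W_graph n) i. hW w) \<le> 2 * hW i" if "i \<in> {1..n}" for i
    by (rule sum_le_sum_superset[OF W_graph_neighbours[OF n]])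
       (use n in \<open>auto simp: hW_def sum.insert_if\<close>)
  have pos: "\<forall>v. hY v > 0" "\<forall>v. hW v > 0" by (auto simp: hY_def hW_def)
  consider "H = P_graph n" | "H = C_graph n" | "H = Y_graph n" | "H = W_graph n" using H by blast
  thus ?thesis
  proof cases
    case 1
    thus ?thesis using P special_graph_wf(1)[OF n H] by (intro exI[of _ "\<lambda>_. 1"]) auto
  next
    case 2
    thus ?thesis using C special_graph_wf(1)[OF n H] by (intro exI[of _ "\<lambda>_. 1"]) auto
  next
    case 3
    thus ?thesis using Y pos special_graph_wf(1)[OF n H] by (intro exI[of _ hY]) auto
  next
    case 4
    thus ?thesis using W pos special_graph_wf(1)[OF n H] by (intro exI[of _ hW]) auto
  qed
qed

lemma (in pair_graph) eigenvalue_sum_less_special: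
  assumes "Digraph_Component.connected (with_proj G)" and "graph_iso G H"
    and "2 \<le> k" "k \<le> card (pverts G)" and n: "n \<ge> 6" and H: "H \<in> {P_graph n, C_graph n, Y_graph n, W_graph n}"
  shows "eigenvalue_sum k G < 2 * real k"
proof -
  obtain h :: "nat \<Rightarrow> real" where h: "\<And>v. h v > 0"
    "\<And>v. v \<in> pverts H \<Longrightarrow> (\<Sum>w\<in>neighbours H v. h w) \<le> 2 * h v"
    using special_graph_supersolution[OF n H] by blast
  have "finite (neighbours H v) \<and> neighbours H v \<subseteq> pverts H" if "v \<in> pverts H" for v
    using special_graph_wf[OF n H] finite_subset[of "neighbours H v" "{1..n}"]
    by (auto simp: neighbours_def)
  thus ?thesis
    using eigenvalue_sum_less_iso[OF assms(1,2,3,4), of h] h by blast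
qed

section \<open>Test vectors\<close>

text \<open>A Rayleigh quotient with the denominator multiplied out, so that normalisation can wait
  until the vectors are combined. \<open>S\<close> may contain elements that are no vertices, as
  balls given by \<open>graph_dist\<close> may; only values at vertices count.\<close>

definition rayleigh_on :: "'a pair_pre_digraph \<Rightarrow> 'a set \<Rightarrow> real \<Rightarrow> bool" where
  "rayleigh_on G S q \<longleftrightarrow> (\<exists>f. (\<forall>v. v \<notin> S \<longrightarrow> f v = 0) \<and> (\<Sum>v\<in>pverts G. (f v)\<^sup>2) > 0 \<and>
     q * (\<Sum>v\<in>pverts G. (f v)\<^sup>2) \<le> quad_form G f)"

lemma rayleigh_on_mono: "rayleigh_on G S q \<Longrightarrow> S \<subseteq> T \<Longrightarrow> q' \<le> q \<Longrightarrow> rayleigh_on G T q'"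
  unfolding rayleigh_on_def by (meson less_imp_le mult_right_mono order_trans subsetD)

context pair_graph
begin

lemma quad_form_scale: "quad_form G (\<lambda>v. a * f v) = a\<^sup>2 * quad_form G f"
  unfolding quad_form_def sum_distrib_left case_prod_unfold
  by (rule sum.cong) (simp_all add: power2_eq_square)

text \<open>Disjoint supports make the vectors orthogonal, whether or not edges join the supports:
  Ky Fan's principle involves only the quadratic forms of the single vectors, never the mixed
  terms.\<close>

lemma eigenvalue_sum_ge_disjoint:
  assumes ray: "\<And>j. j < k \<Longrightarrow> rayleigh_on G (S j) (q j)"
    and disj: "\<And>i j. i < k \<Longrightarrow> j < k \<Longrightarrow> i \<noteq> j \<Longrightarrow> S i \<inter> S j = {}"
    and k: "k \<le> card (pverts G)"
  shows "(\<Sum>j<k. q j) \<le> eigenvalue_sum k G"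
proof -
  have "\<forall>j. \<exists>f. j < k \<longrightarrow> (\<forall>v. v \<notin> S j \<longrightarrow> f v = 0) \<and> (\<Sum>v\<in>pverts G. (f v)\<^sup>2) > 0 \<and>
     q j * (\<Sum>v\<in>pverts G. (f v)\<^sup>2) \<le> quad_form G f"
    using ray unfolding rayleigh_on_def by blast
  from choice[OF this] obtain f where f:
    "\<And>j v. j < k \<Longrightarrow> v \<notin> S j \<Longrightarrow> f j v = 0"
    "\<And>j. j < k \<Longrightarrow> (\<Sum>v\<in>pverts G. (f j v)\<^sup>2) > 0"
    "\<And>j. j < k \<Longrightarrow> q j * (\<Sum>v\<in>pverts G. (f j v)\<^sup>2) \<le> quad_form G (f j)" by blast
  define N where "N j = (\<Sum>v\<in>pverts G. (f j v)\<^sup>2)" for j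
  have N: "N j > 0" if "j < k" for j using f(2) that by (simp add: N_def)
  define x where "x j v = 1 / sqrt (N j) * f j v" for j v
  have "(\<Sum>v\<in>pverts G. x i v * x j v) = (if i = j then 1 else 0)" if ij: "i < k" "j < k" for i j
  proof (cases "i = j")
    case True
    have "(\<Sum>v\<in>pverts G. x i v * x i v) = (1 / sqrt (N i))\<^sup>2 * N i"
      unfolding N_def x_def sum_distrib_left by (intro sum.cong) (auto simp: power2_eq_square)
    thus ?thesis using True N[OF ij(1)] by (simp add: power_divide)
  next
    case False
    have "x i v * x j v = 0" for v
      using disj[OF ij False] f(1) ij unfolding x_def by (metis disjoint_iff mult_eq_0_iff)
    hence "(\<Sum>v\<in>pverts G. x i v * x j v) = 0" by (intro sum.neutral) blast
    thus ?thesis using False by simp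
  qed
  from ky_fan[OF this k] have "(\<Sum>j<k. quad_form G (x j)) \<le> eigenvalue_sum k G" .
  moreover have "(\<Sum>j<k. q j) \<le> (\<Sum>j<k. quad_form G (x j))"
  proof (rule sum_mono)
    fix j assume "j \<in> {..<k}"
    hence j: "j < k" by simp
    have "quad_form G (x j) = quad_form G (f j) / N j"
      unfolding x_def using quad_form_scale[of "1 / sqrt (N j)" "f j"] N[OF j]
      by (simp add: power_divide)
    thus "q j \<le> quad_form G (x j)" using f(3)[OF j] N[OF j] by (simp add: N_def[symmetric] le_divide_eq)
  qed
  ultimately show ?thesis by linarith
qed

text \<open>Nonnegative weights make further edges between the image vertices harmless, as they only
  raise the quadratic form; so \<open>E\<close> may describe any subgraph, induced or not. Listing
  each edge once, with \<open>a < b\<close>, accounts for the factor 2.\<close>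

lemma rayleigh_on_embedding:
  fixes w :: "nat \<Rightarrow> real"
  assumes inj: "inj_on p {..<N}" and pV: "p ` {..<N} \<subseteq> pverts G"
    and w: "\<And>a. a < N \<Longrightarrow> w a \<ge> 0" and pos: "(\<Sum>a<N. (w a)\<^sup>2) > 0"
    and E: "finite E" "\<And>a b. (a, b) \<in> E \<Longrightarrow> a < b \<and> b < N \<and> (p a, p b) \<in> parcs G"
    and q: "q * (\<Sum>a<N. (w a)\<^sup>2) \<le> 2 * (\<Sum>(a, b)\<in>E. w a * w b)"
  shows "rayleigh_on G (p ` {..<N}) q"
proof -
  define f where "f v = (if v \<in> p ` {..<N} then w (the_inv_into {..<N} p v) else 0)" for v
  have fp: "f (p a) = w a" if "a < N" for a
    using that inj by (auto simp: f_def the_inv_into_f_f)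
  have f0: "f v = 0" if "v \<notin> p ` {..<N}" for v using that by (simp add: f_def)
  have nn: "f v \<ge> 0" for v
    using w inj by (auto simp: f_def the_inv_into_f_f)
  have sq: "(\<Sum>v\<in>pverts G. (f v)\<^sup>2) = (\<Sum>a<N. (w a)\<^sup>2)"
  proof -
    have "(\<Sum>v\<in>pverts G. (f v)\<^sup>2) = (\<Sum>v\<in>p ` {..<N}. (f v)\<^sup>2)"
      using pV pair_finite_verts f0 by (intro sum.mono_neutral_right) auto
    also have "\<dots> = (\<Sum>a<N. (f (p a))\<^sup>2)" using sum.reindex[OF inj] by (simp add: comp_def)
    finally show ?thesis using fp by simp
  qed
  let ?E = "E \<union> E\<inverse>"
  have EN: "?E \<subseteq> {..<N} \<times> {..<N}" using E(2) by force
  have injE: "inj_on (map_prod p p) ?E"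
    using inj_on_subset[OF map_prod_inj_on[OF inj inj] EN] .
  have "map_prod p p ` ?E \<subseteq> parcs G" using E(2) arcs_symmetric by auto
  have "(\<Sum>(a, b)\<in>E. w a * w b) = (\<Sum>(a, b)\<in>E\<inverse>. w a * w b)"
    by (rule sum.reindex_bij_witness[of _ prod.swap prod.swap]) (auto simp: mult.commute)
  hence "2 * (\<Sum>(a, b)\<in>E. w a * w b) = (\<Sum>(a, b)\<in>E. w a * w b) + (\<Sum>(a, b)\<in>E\<inverse>. w a * w b)"
    by simp
  also have "\<dots> = (\<Sum>(a, b)\<in>?E. w a * w b)"
    using E by (subst sum.union_disjoint) (auto dest!: E(2))
  also have "\<dots> = (\<Sum>(a, b)\<in>?E. f (p a) * f (p b))"
    using EN fp by (intro sum.cong) auto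
  also have "\<dots> = (\<Sum>(u, v)\<in>map_prod p p ` ?E. f u * f v)"
    using sum.reindex[OF injE, of "\<lambda>(u, v). f u * f v"] by (simp add: comp_def case_prod_unfold)
  also have "\<dots> \<le> quad_form G f"
    unfolding quad_form_def
  proof (rule sum_mono2[OF pair_finite_arcs \<open>map_prod p p ` ?E \<subseteq> parcs G\<close>])
    fix e
    have "f (fst e) * f (snd e) \<ge> 0" by (intro mult_nonneg_nonneg nn)
    thus "0 \<le> (case e of (u, v) \<Rightarrow> f u * f v)" by (simp add: case_prod_unfold)
  qed
  finally have "2 * (\<Sum>(a, b)\<in>E. w a * w b) \<le> quad_form G f" .
  thus ?thesis unfolding rayleigh_on_def using f0 sq pos q by (intro exI[of _ f]) auto
qed

lemma rayleigh_on_vertex: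
  assumes "v \<in> pverts G"
  shows "rayleigh_on G {v} 0"
proof -
  have "rayleigh_on G ((\<lambda>_. v) ` {..<Suc 0}) 0"
    by (rule rayleigh_on_embedding[where w = "\<lambda>_. 1" and E = "{}"]) (use assms in \<open>auto simp: inj_on_def\<close>)
  thus ?thesis by (simp add: lessThan_Suc)
qed

text \<open>A star with \<open>m^2\<close> leaves has index \<open>m\<close>, with Perron vector
  \<open>m\<close> at the centre and 1 at the leaves; a square number of leaves keeps the weights
  integral.\<close>

lemma rayleigh_on_star:
  assumes T: "T \<subseteq> neighbours G v" "card T = m\<^sup>2" and m: "m > 0"
  shows "rayleigh_on G (insert v T) (real m)"
proof -
  have fin: "finite T" using T(1) finite_subset by fastforce
  obtain g where g: "bij_betw g {..<m\<^sup>2} T"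
    using ex_bij_betw_nat_finite[OF fin] T(2) by (auto simp: atLeast0LessThan)
  define p where "p i = (case i of 0 \<Rightarrow> v | Suc j \<Rightarrow> g j)" for i
  define w where "w i = (case i of 0 \<Rightarrow> real m | Suc j \<Rightarrow> 1)" for i
  have gT: "g i \<in> T" if "i < m\<^sup>2" for i using g that by (auto simp: bij_betw_def)
  have img: "p ` {..<Suc (m\<^sup>2)} = insert v T"
    unfolding lessThan_Suc_eq_insert_0 image_insert image_image using g
    by (auto simp: p_def bij_betw_def)
  have vT: "v \<notin> T" using T(1) not_neighbour_self by blast
  have "v \<in> pverts G"
  proof -
    have "T \<noteq> {}" using T(2) m by auto
    thus ?thesis using T(1) in_arcsD1 by (auto simp: neighbours_def)
  qed
  have "rayleigh_on G (p ` {..<Suc (m\<^sup>2)}) (real m)"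
  proof (rule rayleigh_on_embedding[where w = w and E = "(\<lambda>i. (0, Suc i)) ` {..<m\<^sup>2}"])
    show "inj_on p {..<Suc (m\<^sup>2)}"
      using g gT vT by (auto simp: inj_on_def p_def bij_betw_def split: nat.splits)
    show "p ` {..<Suc (m\<^sup>2)} \<subseteq> pverts G"
      unfolding img using T(1) neighbours_subset \<open>v \<in> pverts G\<close> by blast
    show "(\<Sum>a<Suc (m\<^sup>2). (w a)\<^sup>2) > 0"
      unfolding sum.lessThan_Suc_shift using m by (simp add: w_def add_pos_nonneg)
    have "(\<Sum>(a, b)\<in>(\<lambda>i. (0, Suc i)) ` {..<m\<^sup>2}. w a * w b) = real m * real (m\<^sup>2)"
      by (subst sum.reindex) (auto simp: inj_on_def w_def comp_def)
    thus "real m * (\<Sum>a<Suc (m\<^sup>2). (w a)\<^sup>2) \<le> 2 * (\<Sum>(a, b)\<in>(\<lambda>i. (0, Suc i)) ` {..<m\<^sup>2}. w a * w b)"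
      unfolding sum.lessThan_Suc_shift by (simp add: w_def)
    have "(v, g i) \<in> parcs G" if "i < m\<^sup>2" for i
      using gT[OF that] T(1) by (auto simp: neighbours_def)
    thus "a < b \<and> b < Suc (m\<^sup>2) \<and> (p a, p b) \<in> parcs G" if "(a, b) \<in> (\<lambda>i. (0, Suc i)) ` {..<m\<^sup>2}" for a b
      using that by (auto simp: p_def)
  qed (auto simp: w_def split: nat.splits)
  thus ?thesis unfolding img .
qed

text \<open>The weights \<open>sin (i * pi / (r + 1))\<close> form the Perron vector of the path.
  They vanish at positions 0 and \<open>r + 1\<close>, so the recurrence from the addition theorem
  holds at the two ends as well.\<close>

lemma rayleigh_on_path:
  assumes inj: "inj_on c {..<r}" and r: "r \<ge> 1"
    and cV: "c ` {..<r} \<subseteq> pverts G" and ed: "\<And>i. Suc i < r \<Longrightarrow> (c i, c (Suc i)) \<in> parcs G"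
  shows "rayleigh_on G (c ` {..<r}) (2 * cos (pi / (real r + 1)))"
proof -
  define t where "t = pi / (real r + 1)"
  define s where "s i = sin (real i * t)" for i
  obtain m where m: "r = Suc m" using r by (metis Suc_le_D One_nat_def)
  have nn: "s i \<ge> 0" if "i \<le> r + 1" for i
  proof -
    have "real i * t \<le> real (r + 1) * t" using that by (intro mult_right_mono) (auto simp: t_def)
    also have "\<dots> = pi" by (simp add: t_def field_simps)
    finally show ?thesis unfolding s_def by (intro sin_ge_zero) (auto simp: t_def)
  qed
  have "t < pi" using r by (simp add: t_def divide_less_eq)
  hence s1: "s 1 > 0" unfolding s_def by (intro sin_gt_zero) (auto simp: t_def)
  have s_end: "s 0 = 0" "s (Suc r) = 0"
  proof -
    have "real (Suc r) * t = pi" by (simp add: t_def field_simps)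
    thus "s (Suc r) = 0" unfolding s_def by simp
  qed (simp add: s_def)
  have rec: "2 * cos t * s (Suc i) = s i + s (Suc (Suc i))" for i
  proof -
    have "s i = sin (real (Suc i) * t - t)" "s (Suc (Suc i)) = sin (real (Suc i) * t + t)"
      by (simp_all add: s_def algebra_simps)
    thus ?thesis by (simp add: sin_diff sin_add s_def)
  qed
  have "2 * cos t * (\<Sum>a<r. (s (Suc a))\<^sup>2) = (\<Sum>a<r. s (Suc a) * s a + s (Suc a) * s (Suc (Suc a)))"
    unfolding sum_distrib_left
  proof (rule sum.cong)
    fix a
    have "2 * cos t * (s (Suc a))\<^sup>2 = (2 * cos t * s (Suc a)) * s (Suc a)" by (simp add: power2_eq_square)
    thus "2 * cos t * (s (Suc a))\<^sup>2 = s (Suc a) * s a + s (Suc a) * s (Suc (Suc a))"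
      unfolding rec by (simp add: algebra_simps)
  qed simp
  also have "\<dots> = (\<Sum>a<Suc m. s (Suc a) * s a) + (\<Sum>a<Suc m. s (Suc a) * s (Suc (Suc a)))"
    unfolding m by (rule sum.distrib)
  \<comment> \<open>Dropping the vanishing end terms turns both sums into the same sum over the
    edges.\<close>
  also have "(\<Sum>a<Suc m. s (Suc a) * s a) = (\<Sum>a<m. s (Suc a) * s (Suc (Suc a)))"
    unfolding sum.lessThan_Suc_shift using s_end by (simp add: mult.commute)
  also have "(\<Sum>a<Suc m. s (Suc a) * s (Suc (Suc a))) = (\<Sum>a<m. s (Suc a) * s (Suc (Suc a)))"
    using s_end m by simp
  finally have eq: "2 * cos t * (\<Sum>a<r. (s (Suc a))\<^sup>2) = 2 * (\<Sum>a<m. s (Suc a) * s (Suc (Suc a)))" by simp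
  show ?thesis unfolding t_def[symmetric]
  proof (rule rayleigh_on_embedding[OF inj cV, where w = "\<lambda>a. s (Suc a)" and E = "(\<lambda>i. (i, Suc i)) ` {..<m}"])
    show "0 < (\<Sum>a<r. (s (Suc a))\<^sup>2)"
      unfolding m sum.lessThan_Suc_shift using s1 by (intro add_pos_nonneg sum_nonneg) auto
    show "2 * cos t * (\<Sum>a<r. (s (Suc a))\<^sup>2) \<le> 2 * (\<Sum>(a, b)\<in>(\<lambda>i. (i, Suc i)) ` {..<m}. s (Suc a) * s (Suc b))"
      unfolding eq by (subst sum.reindex) (auto simp: inj_on_def comp_def)
  qed (use nn ed m in auto)
qed

end

section \<open>Distances, balls and geodesics\<close>

definition graph_dist :: "'a pair_pre_digraph \<Rightarrow> 'a \<Rightarrow> 'a \<Rightarrow> nat" where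
  "graph_dist G u v = (LEAST i. (u, v) \<in> parcs G ^^ i)"

definition fork_ends :: "'a pair_pre_digraph \<Rightarrow> bool" where
  "fork_ends G \<longleftrightarrow> (\<forall>v\<in>pverts G. card (neighbours G v) \<ge> 3 \<longrightarrow> card (neighbours G v) = 3 \<and>
     (\<exists>a b. a \<noteq> b \<and> a \<in> neighbours G v \<and> b \<in> neighbours G v \<and> neighbours G a = {v} \<and> neighbours G b = {v}))"

context pair_graph
begin

context
  fixes u
  assumes con: "Digraph_Component.connected (with_proj G)" and u: "u \<in> pverts G"
begin

lemma graph_dist_relpow:
  assumes "v \<in> pverts G"
  shows "(u, v) \<in> parcs G ^^ graph_dist G u v"
proof -
  let ?S = "{v \<in> pverts G. \<exists>i. (u, v) \<in> parcs G ^^ i}"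
  have "?S = pverts G"
  proof (rule connected_closed_eq[OF con])
    have "(u, u) \<in> parcs G ^^ 0" by simp
    thus "?S \<noteq> {}" using u by blast
    fix v assume "v \<in> ?S"
    then obtain i where i: "(u, v) \<in> parcs G ^^ i" by blast
    have "(u, w) \<in> parcs G ^^ Suc i" if "w \<in> neighbours G v" for w
      using i that by (auto simp: neighbours_def)
    thus "neighbours G v \<subseteq> ?S" using neighbours_subset by blast
  qed auto
  thus ?thesis using assms unfolding graph_dist_def by (auto intro: LeastI)
qed

lemma graph_dist_le: "(u, v) \<in> parcs G ^^ i \<Longrightarrow> graph_dist G u v \<le> i"
  unfolding graph_dist_def by (rule Least_le)

lemma graph_dist_self: "graph_dist G u u = 0"
  using graph_dist_le[of u 0] by simp

lemma graph_dist_eq_0: "v \<in> pverts G \<Longrightarrow> graph_dist G u v = 0 \<Longrightarrow> v = u"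
  using graph_dist_relpow[of v] by simp

lemma graph_dist_neighbour:
  assumes "w \<in> neighbours G v" "v \<in> pverts G"
  shows "graph_dist G u w \<le> Suc (graph_dist G u v)"
  using graph_dist_relpow[OF assms(2)] assms(1) by (intro graph_dist_le) (auto simp: neighbours_def)

lemma graph_dist_Suc:
  assumes v: "v \<in> pverts G" "graph_dist G u v = Suc i"
  shows "\<exists>w\<in>pverts G. v \<in> neighbours G w \<and> graph_dist G u w = i"
proof -
  obtain w where w: "(u, w) \<in> parcs G ^^ i" "(w, v) \<in> parcs G"
    using graph_dist_relpow[OF v(1)] v(2) by auto
  have "w \<in> pverts G" "v \<in> neighbours G w" using w(2) in_arcsD1 by (auto simp: neighbours_def)
  moreover have "graph_dist G u w = i"
    using graph_dist_le[OF w(1)] graph_dist_neighbour[of v w] calculation v(2) by simp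
  ultimately show ?thesis by blast
qed

text \<open>Degrees below \<open>D\<close> bound closed neighbourhoods by \<open>D\<close>, so each
  step multiplies the size of the ball by at most \<open>D\<close>, without an additive
  constant.\<close>

lemma ball_card_le:
  assumes deg: "\<And>v. v \<in> pverts G \<Longrightarrow> card (neighbours G v) < D"
  shows "card {v \<in> pverts G. graph_dist G u v \<le> i} \<le> D ^ i"
proof (induction i)
  case 0
  have "{v \<in> pverts G. graph_dist G u v \<le> 0} = {u}"
    using graph_dist_eq_0 graph_dist_self u by auto
  thus ?case by simp
next
  case (Suc i)
  let ?B = "\<lambda>i. {v \<in> pverts G. graph_dist G u v \<le> i}"
  have fin: "finite (?B i)" using pair_finite_verts by simp
  have "?B (Suc i) \<subseteq> (\<Union>w\<in>?B i. insert w (neighbours G w))"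
  proof
    fix v assume v: "v \<in> ?B (Suc i)"
    show "v \<in> (\<Union>w\<in>?B i. insert w (neighbours G w))"
    proof (cases "graph_dist G u v = Suc i")
      case True
      thus ?thesis using graph_dist_Suc[of v i] v by auto
    qed (use v in auto)
  qed
  hence "card (?B (Suc i)) \<le> card (\<Union>w\<in>?B i. insert w (neighbours G w))"
    using fin by (intro card_mono) auto
  also have "\<dots> \<le> (\<Sum>w\<in>?B i. card (insert w (neighbours G w)))"
    using fin by (rule card_UN_le)
  also have "\<dots> \<le> (\<Sum>w\<in>?B i. D)"
    using deg by (intro sum_mono order_trans[OF card_insert_le_m1]) (auto intro: Suc_leI simp: card_insert_if)
  also have "\<dots> \<le> D ^ i * D" using Suc.IH by simp
  finally show ?case by (simp add: mult.commute)
qed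

text \<open>That \<open>c i\<close> lies at distance \<open>i\<close> is part of the statement
  because it yields injectivity of \<open>c\<close> and later separates the pieces cut from
  it.\<close>

lemma geodesic_exists:
  assumes "v \<in> pverts G"
  shows "\<exists>c. c (graph_dist G u v) = v \<and>
    (\<forall>i\<le>graph_dist G u v. c i \<in> pverts G \<and> graph_dist G u (c i) = i) \<and>
    (\<forall>i<graph_dist G u v. c (Suc i) \<in> neighbours G (c i))"
  using assms
proof (induction "graph_dist G u v" arbitrary: v)
  case 0
  thus ?case by (intro exI[of _ "\<lambda>_. v"]) auto
next
  case (Suc i)
  then obtain w where w: "w \<in> pverts G" "v \<in> neighbours G w" "graph_dist G u w = i"
    using graph_dist_Suc[of v i] by metis
  from Suc.hyps(1)[OF w(3)[symmetric] w(1)] obtain c where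
    c: "c i = w" "\<And>j. j \<le> i \<Longrightarrow> c j \<in> pverts G \<and> graph_dist G u (c j) = j"
      "\<And>j. j < i \<Longrightarrow> c (Suc j) \<in> neighbours G (c j)"
    using w(3) by blast
  show ?case
    unfolding Suc.hyps(2)[symmetric]
    by (rule exI[of _ "\<lambda>j. if j \<le> i then c j else v"])
       (use c w Suc.hyps(2)[symmetric] Suc.prems in \<open>auto simp: le_Suc_eq less_Suc_eq\<close>)
qed

end

section \<open>Small subgraphs of index at least 2.0194\<close>

lemma rayleigh_on_list:
  fixes ws :: "real list"
  assumes ps: "distinct ps" "set ps \<subseteq> pverts G"
    and ws: "length ws = length ps" "\<forall>x\<in>set ws. x \<ge> 0" "(\<Sum>x\<leftarrow>ws. x\<^sup>2) > 0"
    and E: "finite E" "\<And>a b. (a, b) \<in> E \<Longrightarrow> a < b \<and> b < length ps \<and> (ps ! a, ps ! b) \<in> parcs G"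
    and q: "q * (\<Sum>x\<leftarrow>ws. x\<^sup>2) \<le> 2 * (\<Sum>(a, b)\<in>E. ws ! a * ws ! b)"
  shows "rayleigh_on G (set ps) q"
proof -
  have s: "(\<Sum>x\<leftarrow>ws. x\<^sup>2) = (\<Sum>a<length ps. (ws ! a)\<^sup>2)"
    by (simp add: sum_list_sum_nth ws(1) atLeast0LessThan)
  have im: "(!) ps ` {..<length ps} = set ps"
    by (auto simp: set_conv_nth)
  have "rayleigh_on G ((!) ps ` {..<length ps}) q"
  proof (rule rayleigh_on_embedding[where w = "(!) ws" and E = E])
    show "inj_on ((!) ps) {..<length ps}" using ps(1) by (simp add: inj_on_nth)
    show "(!) ps ` {..<length ps} \<subseteq> pverts G" unfolding im by (rule ps)
    show "0 \<le> ws ! a" if "a < length ps" for a using ws(1,2) that by simp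
    show "0 < (\<Sum>a<length ps. (ws ! a)\<^sup>2)" using ws(3) s by simp
    show "q * (\<Sum>a<length ps. (ws ! a)\<^sup>2) \<le> 2 * (\<Sum>(a, b)\<in>E. ws ! a * ws ! b)" using q s by simp
  qed (use E in auto)
  thus ?thesis unfolding im .
qed

text \<open>The star with four leaves has index exactly 2, as do the triangle and the four-cycle, so
  in each of the three lemmas starting here one vertex is added to such a graph. The weights are
  rounded multiples of Perron vectors, and 10097/5000 is 2 + 2 * 0.0097. The quotients reached,
  between 2.07 and 2.17, leave ample room.\<close>

lemma rayleigh_on_K14_tail:
  assumes "distinct [u, x, y, z, v, w]" "{x, y, z, v} \<subseteq> neighbours G u" "w \<in> neighbours G v"
  shows "rayleigh_on G {u, x, y, z, v, w} (10097 / 5000)"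
proof -
  have "rayleigh_on G (set [u, x, y, z, v, w]) (10097 / 5000)"
    by (rule rayleigh_on_list[where ws = "[100, 48, 48, 48, 63, 30]" and E = "{(0, 1), (0, 2), (0, 3), (0, 4), (4, 5)}"])
       (use assms in_arcsD1 in_arcsD2 in \<open>auto simp: neighbours_def\<close>)
  thus ?thesis by simp
qed

lemma rayleigh_on_paw:
  assumes "distinct [u, x, y, z]" "{x, y, z} \<subseteq> neighbours G u" "y \<in> neighbours G x"
  shows "rayleigh_on G {u, x, y, z} (10097 / 5000)"
proof -
  have "rayleigh_on G (set [u, x, y, z]) (10097 / 5000)"
    by (rule rayleigh_on_list[where ws = "[7, 6, 6, 3]" and E = "{(0, 1), (0, 2), (0, 3), (1, 2)}"])
       (use assms in_arcsD1 in_arcsD2 in \<open>auto simp: neighbours_def\<close>)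
  thus ?thesis by simp
qed

lemma rayleigh_on_C4_pendant:
  assumes "distinct [u, x, y, z, w]" "{x, y, z} \<subseteq> neighbours G u" "w \<in> neighbours G x" "w \<in> neighbours G y"
  shows "rayleigh_on G {u, x, y, z, w} (10097 / 5000)"
proof -
  have "rayleigh_on G (set [u, x, y, z, w]) (10097 / 5000)"
    by (rule rayleigh_on_list[where ws = "[100, 83, 83, 47, 78]" and E = "{(0, 1), (0, 2), (0, 3), (1, 4), (2, 4)}"])
       (use assms in_arcsD1 in_arcsD2 in \<open>auto simp: neighbours_def\<close>)
  thus ?thesis by simp
qed

text \<open>The edges of a tree: index 3 is the centre, 0 a leaf attached to it, and the path from 1
  to 23 runs along the arm of length 2 through the centre to the end of the arm of length
  20.\<close>

lemma pendant_path_sum: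
  fixes f :: "nat \<Rightarrow> real"
  shows "(\<Sum>(a, b)\<in>insert (0, 3) ((\<lambda>i. (i, Suc i)) ` {1..<23}). f a * f b) = f 0 * f 3
    + f 1 * f 2 + f 2 * f 3 + f 3 * f 4 + f 4 * f 5 + f 5 * f 6 + f 6 * f 7 + f 7 * f 8 + f 8 * f 9
    + f 9 * f 10 + f 10 * f 11 + f 11 * f 12 + f 12 * f 13 + f 13 * f 14 + f 14 * f 15 + f 15 * f 16
    + f 16 * f 17 + f 17 * f 18 + f 18 * f 19 + f 19 * f 20 + f 20 * f 21 + f 21 * f 22 + f 22 * f 23"
proof -
  have "[2..<23::nat] = [2, 3, 4, 5, 6, 7, 8, 9, 10, 11, 12, 13, 14, 15, 16, 17, 18, 19, 20, 21, 22]" by simp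
  hence "{2..<23::nat} = {2, 3, 4, 5, 6, 7, 8, 9, 10, 11, 12, 13, 14, 15, 16, 17, 18, 19, 20, 21, 22}"
    by (metis list.set(1,2) set_upt)
  moreover have "{1..<23::nat} = insert 1 {2..<23}" by auto
  ultimately have "{1..<23::nat} = {1, 2, 3, 4, 5, 6, 7, 8, 9, 10, 11, 12, 13, 14, 15, 16, 17, 18, 19, 20, 21, 22}" by simp
  thus ?thesis by simp (simp add: numeral_2_eq_2)
qed

text \<open>The tree with arms of lengths 1, 2 and 20 at \<open>c 0\<close>; as the long arm grows the index tends to
  about 2.0198, which is why \<open>\<epsilon> = 0.0097\<close> is admissible. The weights approximate 100 times
  the Perron vector.\<close>

lemma rayleigh_on_T_1_2_20:
  assumes c: "inj_on c {..20}" "\<And>i. i < 20 \<Longrightarrow> c (Suc i) \<in> neighbours G (c i)"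
    and ab: "a \<in> neighbours G (c 0)" "b \<in> neighbours G (c 0)" "d \<in> neighbours G b"
    and dist: "distinct [a, d, b]" "{a, d, b} \<inter> c ` {..20} = {}"
  shows "rayleigh_on G ({a, d, b} \<union> c ` {..20}) (10097 / 5000)"
proof -
  define cs where "cs = map c [0..<21]"
  have len: "length cs = 21" and nth: "\<And>i. i < 21 \<Longrightarrow> cs ! i = c i"
    unfolding cs_def by (simp_all only: length_map length_upt nth_map nth_upt, simp_all)
  have set_cs: "set cs = c ` {..20}" unfolding cs_def set_map set_upt by (rule arg_cong[of _ _ "image c"]) auto
  have "distinct cs"
    unfolding distinct_conv_nth len using c(1) nth by (auto simp: inj_on_def)
  let ?ps = "[a, d, b] @ cs"
  let ?ws = "[50, 32, 66, 100, 87, 75, 65, 57, 49, 43, 37, 32, 27, 24, 20, 17, 15, 12, 10, 8, 6, 5, 3, 1] :: real list"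
  let ?E = "insert (0, 3) ((\<lambda>i. (i, Suc i)) ` {1..<23}) :: (nat \<times> nat) set"
  have set: "set ?ps = {a, d, b} \<union> c ` {..20}" using set_cs by auto
  have nth0: "?ps ! (j + 3) = c j" if "j < 21" for j
    using nth[OF that] by (simp add: nth_append)
  have arc: "(?ps ! i, ?ps ! Suc i) \<in> parcs G" if i: "1 \<le> i" "i < 23" for i
  proof -
    have "i = 1 \<or> i = 2 \<or> (\<exists>j<20. i = j + 3)" using i by presburger
    then consider "i = 1" | "i = 2" | j where "i = j + 3" "j < 20" by blast
    thus ?thesis
    proof cases
      case 1
      thus ?thesis using ab arcs_symmetric by (simp add: neighbours_def)
    next
      case 2
      thus ?thesis using ab nth0[of 0] by (simp add: neighbours_def arcs_symmetric)
    next
      case 3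
      thus ?thesis using c(2)[of j] nth0[of j] nth0[of "Suc j"] by (simp add: neighbours_def)
    qed
  qed
  have "rayleigh_on G (set ?ps) (10097 / 5000)"
  proof (rule rayleigh_on_list[where ws = ?ws and E = ?E])
    show "distinct ?ps" using dist \<open>distinct cs\<close> set_cs by auto
    show "set ?ps \<subseteq> pverts G"
    proof -
      have "c i \<in> pverts G" if "i \<le> 20" for i
        using that c(2)[of i] c(2)[of 19] in_arcsD1 in_arcsD2 by (cases "i = 20") (auto simp: neighbours_def)
      thus ?thesis unfolding set using ab neighbours_subset by auto
    qed
    have "(a, c 0) \<in> parcs G" using ab(1) by (simp add: neighbours_def arcs_symmetric)
    hence "(?ps ! 0, ?ps ! 3) \<in> parcs G" using nth0[of 0] by simp
    thus "i < j \<and> j < length ?ps \<and> (?ps ! i, ?ps ! j) \<in> parcs G" if "(i, j) \<in> ?E" for i j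
      using that arc len by auto
    \<comment> \<open>The margin is slim: twice this sum is 96510 and the squared norm is 47789,
      with quotient about 2.0195.\<close>
    have "(\<Sum>(a, b)\<in>?E. ?ws ! a * ?ws ! b) = 48255"
      unfolding pendant_path_sum by simp
    thus "10097 / 5000 * (\<Sum>x\<leftarrow>?ws. x\<^sup>2) \<le> 2 * (\<Sum>(a, b)\<in>?E. ?ws ! a * ?ws ! b)" by simp
  qed (use len in auto)
  thus ?thesis unfolding set .
qed

end

section \<open>Vertices that are not forks\<close>

context pair_graph
begin

text \<open>The neighbours of \<open>u\<close> other than \<open>c 1\<close> decide. If there are
  three or more, there is a star with four leaves, prolonged by \<open>c 2\<close>. If there are
  two, one of them has a further neighbour since \<open>u\<close> is not a fork, and the position of
  that neighbour selects a triangle, a four-cycle or the tree with arms 1, 2 and 20.\<close>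

lemma rayleigh_on_ball_not_fork:
  assumes con: "Digraph_Component.connected (with_proj G)" and u: "u \<in> pverts G"
    and c: "\<And>i. i \<le> 20 \<Longrightarrow> c i \<in> pverts G \<and> graph_dist G u (c i) = i"
      "\<And>i. i < 20 \<Longrightarrow> c (Suc i) \<in> neighbours G (c i)"
    and deg: "card (neighbours G u) \<ge> 3"
    and bad: "\<not> (card (neighbours G u) = 3 \<and> (\<exists>a b. a \<noteq> b \<and> a \<in> neighbours G u \<and> b \<in> neighbours G u
      \<and> neighbours G a = {u} \<and> neighbours G b = {u}))"
  shows "rayleigh_on G {v. graph_dist G u v \<le> 20} (10097 / 5000)"
proof -
  have c0: "c 0 = u" using c(1)[of 0] graph_dist_eq_0[OF con u] by simp
  have d1: "graph_dist G u v = 1" if "v \<in> neighbours G u" for v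
  proof -
    have "graph_dist G u v \<le> 1"
      using graph_dist_neighbour[OF con u that u] graph_dist_self[OF con u] by simp
    moreover have "graph_dist G u v \<noteq> 0"
      using graph_dist_eq_0[OF con u, of v] that not_neighbour_self neighbours_subset by blast
    ultimately show ?thesis by simp
  qed
  have du: "graph_dist G u u = 0" by (rule graph_dist_self[OF con u])
  have dc: "graph_dist G u (c i) = i" if "i \<le> 20" for i using c(1) that by blast
  have c1: "c 1 \<in> neighbours G u" using c(2)[of 0] c0 by simp
  have c2: "c 2 \<in> neighbours G (c 1)" using c(2)[of 1] by (simp add: numeral_2_eq_2)
  define A where "A = neighbours G u - {c 1}"
  have cardA: "card A = card (neighbours G u) - 1" unfolding A_def using c1 by simp
  have dA: "graph_dist G u x = 1" if "x \<in> A" for x using that d1 by (simp add: A_def)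
  show ?thesis
  proof (cases "card A \<ge> 3")
    case True
    then obtain T where T: "T \<subseteq> A" "card T = 3" using obtain_subset_with_card_n by metis
    then obtain x y z where xyz: "T = {x, y, z}" "x \<noteq> y" "x \<noteq> z" "y \<noteq> z"
      by (auto simp: card_3_iff)
    have "rayleigh_on G {u, x, y, z, c 1, c 2} (10097 / 5000)"
    proof (rule rayleigh_on_K14_tail)
      show "distinct [u, x, y, z, c 1, c 2]"
        using xyz T(1) dA[of x] dA[of y] dA[of z] du dc[of 1] dc[of 2] by (auto simp: A_def)
      show "{x, y, z, c 1} \<subseteq> neighbours G u" using xyz T(1) c1 by (auto simp: A_def)
    qed (rule c2)
    thus ?thesis
      by (rule rayleigh_on_mono) (use xyz T(1) dA[of x] dA[of y] dA[of z] du dc[of 1] dc[of 2] in auto)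
  next
    case False
    hence "card A = 2" using cardA deg by linarith
    then obtain a b where ab: "A = {a, b}" "a \<noteq> b" by (auto simp: card_2_iff)
    \<comment> \<open>By symmetry between the two elements of \<open>A\<close>, \<open>y\<close>
      stands for one that is not pendant.\<close>
    have core: ?thesis if A: "A = {x, y}" "x \<noteq> y" and y: "neighbours G y \<noteq> {u}" for x y
    proof -
      have xN: "x \<in> neighbours G u" "x \<noteq> c 1" and yN: "y \<in> neighbours G u" "y \<noteq> c 1"
        using A by (auto simp: A_def)
      have "u \<in> neighbours G y" using yN neighbours_sym by blast
      then obtain w where w: "w \<in> neighbours G y" "w \<noteq> u" using y by blast
      have dx: "graph_dist G u x = 1" and dy: "graph_dist G u y = 1" using xN yN d1 by auto
      have yV: "y \<in> pverts G" using yN neighbours_subset by blast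
      have dw: "graph_dist G u w \<le> 2"
        using graph_dist_neighbour[OF con u w(1) yV] dy by simp
      have wy: "w \<noteq> y" using w not_neighbour_self by blast
      consider "w = x" | "w = c 1" | "w = c 2" | "w \<noteq> x" "w \<noteq> c 1" "w \<noteq> c 2" by blast
      thus ?thesis
      proof cases
        case 1
        have "rayleigh_on G {u, y, x, c 1} (10097 / 5000)"
          by (rule rayleigh_on_paw) (use 1 w A(2) xN yN c1 dx dy dc[of 1] du in auto)
        thus ?thesis by (rule rayleigh_on_mono) (use dx dy dc[of 1] du in auto)
      next
        case 2
        have "rayleigh_on G {u, y, c 1, x} (10097 / 5000)"
          by (rule rayleigh_on_paw) (use 2 w A(2) xN yN c1 dx dy dc[of 1] du in auto)
        thus ?thesis by (rule rayleigh_on_mono) (use dx dy dc[of 1] du in auto)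
      next
        case 3
        have "rayleigh_on G {u, y, c 1, x, c 2} (10097 / 5000)"
          by (rule rayleigh_on_C4_pendant) (use 3 w A(2) xN yN c1 c2 dx dy dc[of 1] dc[of 2] du in auto)
        thus ?thesis by (rule rayleigh_on_mono) (use dx dy dc[of 1] dc[of 2] du in auto)
      next
        case 4
        \<comment> \<open>Since \<open>c i\<close> lies at distance \<open>i\<close>, a vertex at
          distance at most 2 can meet the geodesic only in \<open>c 0\<close>, \<open>c 1\<close> or
          \<open>c 2\<close>.\<close>
        have far: "v \<notin> c ` {..20}" if "graph_dist G u v \<le> 2" "v \<noteq> u" "v \<noteq> c 1" "v \<noteq> c 2" for v
        proof
          assume "v \<in> c ` {..20}"
          then obtain i where i: "i \<le> 20" "v = c i" by auto
          hence "i \<le> 2" using that(1) dc by simp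
          hence "i = 0 \<or> i = 1 \<or> i = 2" by auto
          thus False using i that c0 by auto
        qed
        have "x \<noteq> u" "y \<noteq> u" "x \<noteq> c 2" "y \<noteq> c 2" using dx dy du dc[of 2] by auto
        hence disj: "{x, w, y} \<inter> c ` {..20} = {}"
          using far[of x] far[of y] far[of w] dx dy dw xN yN 4 w by simp
        have "rayleigh_on G ({x, w, y} \<union> c ` {..20}) (10097 / 5000)"
        proof (rule rayleigh_on_T_1_2_20[where c = c, OF _ c(2)])
          show "inj_on c {..20}" by (rule inj_onI) (metis atMost_iff dc)
        qed (use xN yN w c0 A(2) 4 wy disj in auto)
        thus ?thesis by (rule rayleigh_on_mono) (use dx dy dw dc in auto)
      qed
    qed
    have "card (neighbours G u) = 3" using \<open>card A = 2\<close> cardA deg by linarith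
    hence "neighbours G a \<noteq> {u} \<or> neighbours G b \<noteq> {u}"
      using bad ab by (auto simp: A_def)
    thus ?thesis using core[of a b] core[of b a] ab by (auto simp: insert_commute)
  qed
qed

end

text \<open>The ceiling makes \<open>r + 1\<close> at least
  \<open>pi / arccos (1 - 0.0097 / (k - 1))\<close>, so \<open>r\<close> is the least order at which
  a path has index at least \<open>2 - 0.0194 / (k - 1)\<close>. The arccosine is below
  \<open>pi / 2\<close>, hence \<open>r >= 1\<close>.\<close>

lemma r_eps_properties:
  assumes k: "k \<ge> 2"
  shows "r_eps 0.0097 k \<ge> 1"
    and "cos (pi / (real_of_int (r_eps 0.0097 k) + 1)) \<ge> 1 - 0.0097 / (real k - 1)"
proof -
  define y where "y = 1 - 0.0097 / (real k - 1)"
  have "0.0097 / (real k - 1) \<le> 0.0097 / 1" using k by (intro divide_left_mono) auto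
  moreover have "0.0097 / (real k - 1) > 0" using k by simp
  ultimately have y: "0 < y" "y < 1" by (auto simp: y_def)
  have ac: "0 < arccos y" "arccos y < pi / 2"
    using y arccos_lt_bounded[of y] arccos_less_arccos[of 0 y] by (auto simp: arccos_0)
  define p where "p = pi / arccos y"
  have p: "p > 2" unfolding p_def using ac by (simp add: less_divide_eq)
  have r: "r_eps 0.0097 k = \<lceil>p\<rceil> - 1" by (simp add: r_eps_def p_def y_def)
  show "r_eps 0.0097 k \<ge> 1" unfolding r using p by linarith
  have "pi / (real_of_int (r_eps 0.0097 k) + 1) \<le> pi / p"
    unfolding r using p by (intro divide_left_mono) (auto intro: mult_pos_pos)
  also have "\<dots> = arccos y" using ac by (simp add: p_def)
  finally have "cos (arccos y) \<le> cos (pi / (real_of_int (r_eps 0.0097 k) + 1))"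
    unfolding r using p ac by (intro cos_monotone_0_pi_le) auto
  thus "cos (pi / (real_of_int (r_eps 0.0097 k) + 1)) \<ge> 1 - 0.0097 / (real k - 1)"
    using y by (simp add: y_def)
qed

section \<open>Lower bounds for the eigenvalue sum\<close>

context pair_graph
begin

text \<open>The star at \<open>v\<close> supplies all of \<open>2 * k\<close> by itself. Single
  vertices outside it, with quadratic form 0, complete the family of \<open>k\<close> vectors, which
  takes \<open>(2 * k)^2 + 1 + (k - 1)\<close> vertices.\<close>

lemma eigenvalue_sum_ge_large_degree:
  assumes v: "v \<in> pverts G" "card (neighbours G v) \<ge> (2 * k)\<^sup>2"
    and k: "k \<ge> 1" and n: "card (pverts G) \<ge> (2 * k)\<^sup>2 + k"
  shows "eigenvalue_sum k G \<ge> 2 * real k"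
proof -
  obtain T where T: "T \<subseteq> neighbours G v" "card T = (2 * k)\<^sup>2" "finite T"
    using obtain_subset_with_card_n[OF v(2)] by metis
  have "card (insert v T) \<le> (2 * k)\<^sup>2 + 1" using T(2,3) card_insert_if[of T v] by simp
  moreover have "card (pverts G - insert v T) \<ge> card (pverts G) - card (insert v T)"
    by (rule diff_card_le_card_Diff) (use T in simp)
  ultimately have "k - 1 \<le> card (pverts G - insert v T)" using n by linarith
  then obtain W where W: "W \<subseteq> pverts G - insert v T" "card W = k - 1" "finite W"
    using obtain_subset_with_card_n by metis
  obtain g where g: "bij_betw g {..<k - 1} W"
    using ex_bij_betw_nat_finite[OF W(3)] W(2) by (auto simp: atLeast0LessThan)
  define S where "S j = (if j = 0 then insert v T else {g (j - 1)})" for j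
  define q where "q j = (if j = 0 then 2 * real k else 0)" for j :: nat
  have gW: "g (j - 1) \<in> W" if "j < k" "j \<noteq> 0" for j
  proof -
    have "j - 1 < k - 1" using that by linarith
    thus ?thesis using g by (auto simp: bij_betw_def)
  qed
  have "(\<Sum>j<k. q j) \<le> eigenvalue_sum k G"
  proof (rule eigenvalue_sum_ge_disjoint[where S = S])
    fix j assume j: "j < k"
    show "rayleigh_on G (S j) (q j)"
    proof (cases "j = 0")
      case True
      thus ?thesis using rayleigh_on_star[OF T(1), of "2 * k"] T(2) k by (simp add: S_def q_def)
    next
      case False
      thus ?thesis using rayleigh_on_vertex gW[OF j] W(1) by (auto simp: S_def q_def)
    qed
  next
    fix i j assume ij: "i < k" "j < k" "i \<noteq> j"
    have "g (i - 1) \<noteq> g (j - 1)" if "i \<noteq> 0" "j \<noteq> 0"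
    proof
      assume "g (i - 1) = g (j - 1)"
      moreover have "i - 1 < k - 1" "j - 1 < k - 1" using ij that by linarith+
      ultimately have "i - 1 = j - 1" using g by (auto simp: bij_betw_def inj_on_def)
      thus False using that ij by linarith
    qed
    thus "S i \<inter> S j = {}" using gW[OF ij(1)] gW[OF ij(2)] W(1) ij(3) by (auto simp: S_def)
  next
    show "k \<le> card (pverts G)" using n by simp
  qed
  moreover have "(\<Sum>j<k. q j) = 2 * real k" using k by (simp add: q_def)
  ultimately show ?thesis by simp
qed

theorem eigenvalue_sum_ge_not_fork_ends:
  assumes con: "Digraph_Component.connected (with_proj G)" and k: "k \<ge> 2"
    and n: "real (card (pverts G)) \<ge> (2 * real k + 1) powi (20 + 23 * (int k - 1) * r_eps 0.0097 k)"
    and bad: "\<not> fork_ends G"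
  shows "eigenvalue_sum k G \<ge> 2 * real k"
proof -
  define r where "r = nat (r_eps 0.0097 k)"
  have ri: "int r = r_eps 0.0097 k" and r1: "r \<ge> 1" using r_eps_properties(1)[OF k] by (auto simp: r_def)
  have ex: "20 + 23 * (int k - 1) * r_eps 0.0097 k = int (20 + 23 * (k - 1) * r)"
    unfolding ri[symmetric] using k by (simp add: of_nat_diff)
  have "real ((2 * k + 1) ^ (20 + 23 * (k - 1) * r)) = (2 * real k + 1) powi (20 + 23 * (int k - 1) * r_eps 0.0097 k)"
    unfolding ex power_int_of_nat by (simp add: add.commute)
  hence "real ((2 * k + 1) ^ (20 + 23 * (k - 1) * r)) \<le> real (card (pverts G))" using n by simp
  hence size: "(2 * k + 1) ^ (20 + 23 * (k - 1) * r) \<le> card (pverts G)" by (simp only: of_nat_le_iff)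
  have "(2 * k + 1) ^ 2 \<le> (2 * k + 1) ^ (20 + 23 * (k - 1) * r)" by (rule power_increasing) auto
  hence size2: "(2 * k)\<^sup>2 + k \<le> card (pverts G)" using size by (simp add: power2_eq_square)
  show ?thesis
  proof (cases "\<exists>v\<in>pverts G. card (neighbours G v) \<ge> (2 * k)\<^sup>2")
    case True
    thus ?thesis using eigenvalue_sum_ge_large_degree size2 k by auto
  next
    case False
    hence deg: "card (neighbours G v) < (2 * k)\<^sup>2" if "v \<in> pverts G" for v using that by force
    obtain u where u: "u \<in> pverts G" "card (neighbours G u) \<ge> 3"
      "\<not> (card (neighbours G u) = 3 \<and> (\<exists>a b. a \<noteq> b \<and> a \<in> neighbours G u \<and> b \<in> neighbours G u
        \<and> neighbours G a = {u} \<and> neighbours G b = {u}))"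
      using bad unfolding fork_ends_def by blast
    \<comment> \<open>Vertices \<open>c 0\<close> to \<open>c 20\<close> serve the small subgraph,
      and \<open>c 21\<close> to \<open>c M\<close> are exactly the \<open>(k - 1) * r\<close>
      vertices of the paths.\<close>
    define M where "M = 20 + (k - 1) * r"
    have "\<exists>v\<in>pverts G. graph_dist G u v \<ge> M"
    proof (rule ccontr)
      assume "\<not> ?thesis"
      hence "pverts G = {v \<in> pverts G. graph_dist G u v \<le> M}" by force
      hence "card (pverts G) \<le> ((2 * k)\<^sup>2) ^ M"
        using ball_card_le[OF con u(1) deg, of M] by simp
      also have "\<dots> = (2 * k) ^ (2 * M)" by (simp add: power_mult)
      also have "\<dots> < (2 * k + 1) ^ (2 * M)" by (rule power_strict_mono) (auto simp: M_def)
      also have "\<dots> \<le> (2 * k + 1) ^ (20 + 23 * (k - 1) * r)"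
      proof (rule power_increasing)
        \<comment> \<open>The degree bound is a square, which doubles the exponent to
          \<open>40 + 2 * X\<close>; as \<open>X >= 1\<close>, this is at most
          \<open>20 + 23 * X\<close>.\<close>
        define X where "X = (k - 1) * r"
        have "1 \<le> X" using mult_le_mono[of 1 "k - 1" 1 r] k r1 by (simp add: X_def)
        thus "2 * M \<le> 20 + 23 * (k - 1) * r" unfolding M_def mult.assoc X_def[symmetric] by presburger
      qed simp
      finally show False using size by simp
    qed
    then obtain v where v: "v \<in> pverts G" "graph_dist G u v \<ge> M" by blast
    from geodesic_exists[OF con u(1) v(1)] obtain c where c:
      "\<And>i. i \<le> M \<Longrightarrow> c i \<in> pverts G \<and> graph_dist G u (c i) = i"
      "\<And>i. i < M \<Longrightarrow> c (Suc i) \<in> neighbours G (c i)"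
      using v(2) by (metis order_less_le_trans order_trans)
    define B where "B j = (\<lambda>i. c (21 + (j - 1) * r + i)) ` {..<r}" for j
    define S where "S j = (if j = 0 then {v. graph_dist G u v \<le> 20} else B j)" for j
    define q where "q j = (if j = 0 then 10097 / 5000 else 2 * cos (pi / (real r + 1)))" for j :: nat
    have idx: "21 + (j - 1) * r + i \<le> M" if "j < k" "j \<noteq> 0" "i < r" for i j
    proof -
      have "j * r = (j - 1) * r + r" using that(2) by (cases j) auto
      moreover have "j * r \<le> (k - 1) * r" using that by (intro mult_le_mono1) linarith
      ultimately show ?thesis using that(3) by (simp add: M_def)
    qed
    \<comment> \<open>Distance from \<open>u\<close> identifies the piece: it is at most 20 on
      \<open>S 0\<close>, and otherwise the block number is read off by division. This gives
      disjointness.\<close>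
    have SB: "graph_dist G u x \<ge> 21 \<and> (graph_dist G u x - 21) div r = j - 1" if xj: "x \<in> S j" "j < k" "j \<noteq> 0" for x j
    proof -
      obtain i where i: "i < r" "x = c (21 + (j - 1) * r + i)" using xj by (auto simp: S_def B_def)
      have "graph_dist G u x = 21 + (j - 1) * r + i" using i c(1) idx[OF xj(2,3) i(1)] by simp
      thus ?thesis using i(1) by simp
    qed
    have "(\<Sum>j<k. q j) \<le> eigenvalue_sum k G"
    proof (rule eigenvalue_sum_ge_disjoint[where S = S])
      fix j assume j: "j < k"
      show "rayleigh_on G (S j) (q j)"
      proof (cases "j = 0")
        case True
        have "rayleigh_on G {v. graph_dist G u v \<le> 20} (10097 / 5000)"
          by (rule rayleigh_on_ball_not_fork[where c = c, OF con u(1) _ _ u(2,3)]) (use c in \<open>auto simp: M_def\<close>)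
        thus ?thesis using True by (simp add: S_def q_def)
      next
        case False
        have "rayleigh_on G (B j) (2 * cos (pi / (real r + 1)))"
          unfolding B_def
        proof (rule rayleigh_on_path[OF _ r1])
          show "inj_on (\<lambda>i. c (21 + (j - 1) * r + i)) {..<r}"
          proof (rule inj_onI)
            fix x y assume "x \<in> {..<r}" "y \<in> {..<r}" "c (21 + (j - 1) * r + x) = c (21 + (j - 1) * r + y)"
            thus "x = y" using c(1)[OF idx[OF j False]] by (metis add_left_cancel lessThan_iff)
          qed
          show "(\<lambda>i. c (21 + (j - 1) * r + i)) ` {..<r} \<subseteq> pverts G"
            using c(1)[OF idx[OF j False]] by auto
          show "(c (21 + (j - 1) * r + i), c (21 + (j - 1) * r + Suc i)) \<in> parcs G" if "Suc i < r" for i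
            using c(2)[of "21 + (j - 1) * r + i"] idx[OF j False that] by (simp add: neighbours_def)
        qed
        thus ?thesis using False by (simp add: S_def q_def)
      qed
    next
      fix i j assume ij: "i < k" "j < k" "i \<noteq> j"
      show "S i \<inter> S j = {}"
      proof (rule ccontr)
        assume "S i \<inter> S j \<noteq> {}"
        then obtain x where x: "x \<in> S i" "x \<in> S j" by blast
        have zero: "graph_dist G u x \<le> 20" if "x \<in> S 0" using that by (simp add: S_def)
        have "i \<noteq> 0"
        proof
          assume "i = 0"
          hence "graph_dist G u x \<le> 20" "j \<noteq> 0" using zero x(1) ij(3) by auto
          thus False using SB[OF x(2) ij(2)] by simp
        qed
        moreover have "j \<noteq> 0"
        proof
          assume "j = 0"
          hence "graph_dist G u x \<le> 20" "i \<noteq> 0" using zero x(2) ij(3) by auto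
          thus False using SB[OF x(1) ij(1)] by simp
        qed
        ultimately show False using SB[OF x(1) ij(1)] SB[OF x(2) ij(2)] ij(3) by simp
      qed
    next
      show "k \<le> card (pverts G)" using size2 by simp
    qed
    \<comment> \<open>\<open>2.0194 + (k - 1) * (2 - 0.0194 / (k - 1)) = 2 * k\<close>: the surplus
      of the small subgraph is spent exactly.\<close>
    moreover have "(\<Sum>j<k. q j) \<ge> 2 * real k"
    proof -
      obtain m where m: "k = Suc m" using k by (cases k) auto
      have "(\<Sum>j<k. q j) = 10097 / 5000 + real m * (2 * cos (pi / (real r + 1)))"
        unfolding m sum.lessThan_Suc_shift by (simp add: q_def)
      moreover have "cos (pi / (real r + 1)) \<ge> 1 - 0.0097 / real m"
        using r_eps_properties(2)[OF k] ri m by (metis (no_types, lifting) add_diff_cancel_right' of_int_of_nat_eq of_nat_Suc add.commute)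
      hence "real m * (2 * cos (pi / (real r + 1))) \<ge> real m * (2 * (1 - 0.0097 / real m))"
        by (intro mult_left_mono) auto
      moreover have "real m * (2 * (1 - 0.0097 / real m)) = 2 * real m - 0.0194"
        using k m by (simp add: field_simps)
      ultimately show ?thesis using m by simp
    qed
    ultimately show ?thesis by linarith
  qed
qed

end

section \<open>Longest paths\<close>

text \<open>Indexed from 1 like the vertices of \<open>P_graph\<close>, so that \<open>p\<close>
  itself can serve as the vertex numbering of an isomorphism.\<close>

definition vertex_path :: "'a pair_pre_digraph \<Rightarrow> (nat \<Rightarrow> 'a) \<Rightarrow> nat \<Rightarrow> bool" where
  "vertex_path G p l \<longleftrightarrow> inj_on p {1..l} \<and> p ` {1..l} \<subseteq> pverts G \<and>
     (\<forall>i. 1 \<le> i \<and> i < l \<longrightarrow> p (Suc i) \<in> neighbours G (p i))"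

definition longest_path :: "'a pair_pre_digraph \<Rightarrow> (nat \<Rightarrow> 'a) \<Rightarrow> nat \<Rightarrow> bool" where
  "longest_path G p l \<longleftrightarrow> vertex_path G p l \<and> (\<forall>q m. vertex_path G q m \<longrightarrow> m \<le> l)"

context pair_graph
begin

lemma longest_path_exists:
  assumes "pverts G \<noteq> {}"
  obtains p l where "longest_path G p l" "l \<ge> 1"
proof -
  obtain v where v: "v \<in> pverts G" using assms by blast
  have v1: "vertex_path G (\<lambda>_. v) 1" using v by (auto simp: vertex_path_def)
  have bound: "l \<le> card (pverts G)" if "vertex_path G p l" for p l
    using card_inj_on_le[of p "{1..l}" "pverts G"] that pair_finite_verts by (auto simp: vertex_path_def)
  define L where "L = {l. \<exists>p. vertex_path G p l}"
  have fin: "finite L" by (rule finite_subset[of _ "{..card (pverts G)}"]) (use bound in \<open>auto simp: L_def\<close>)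
  have 1: "1 \<in> L" using v1 by (auto simp: L_def)
  hence "Max L \<in> L" using fin by (intro Max_in) auto
  then obtain p where "vertex_path G p (Max L)" by (auto simp: L_def)
  moreover have "m \<le> Max L" if "vertex_path G q m" for q m
    using that fin by (intro Max_ge) (auto simp: L_def)
  ultimately show ?thesis using that[of p "Max L"] 1 fin by (auto simp: longest_path_def)
qed

text \<open>Reversal carries results about the last vertex over to the first, and reduces a fork at
  the far end to one at the start.\<close>

lemma vertex_path_reverse:
  assumes "vertex_path G p l"
  shows "vertex_path G (\<lambda>i. p (Suc l - i)) l"
proof -
  have inj: "inj_on p {1..l}" and sub: "p ` {1..l} \<subseteq> pverts G"
    and step: "\<And>i. 1 \<le> i \<Longrightarrow> i < l \<Longrightarrow> p (Suc i) \<in> neighbours G (p i)"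
    using assms by (auto simp: vertex_path_def)
  have "inj_on (\<lambda>i. p (Suc l - i)) {1..l}"
  proof (rule inj_onI)
    fix x y assume xy: "x \<in> {1..l}" "y \<in> {1..l}" "p (Suc l - x) = p (Suc l - y)"
    hence "Suc l - x = Suc l - y" by (intro inj_onD[OF inj]) auto
    thus "x = y" using xy by auto
  qed
  moreover have "p (Suc l - Suc i) \<in> neighbours G (p (Suc l - i))" if i: "1 \<le> i" "i < l" for i
  proof -
    have "p (Suc (l - i)) \<in> neighbours G (p (l - i))" using step[of "l - i"] i by simp
    thus ?thesis using i neighbours_sym by (simp add: Suc_diff_le)
  qed
  moreover have "(\<lambda>i. p (Suc l - i)) ` {1..l} \<subseteq> pverts G"
  proof
    fix y assume "y \<in> (\<lambda>i. p (Suc l - i)) ` {1..l}"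
    then obtain i where "i \<in> {1..l}" "y = p (Suc l - i)" by blast
    moreover from this have "Suc l - i \<in> {1..l}" by auto
    ultimately show "y \<in> pverts G" using sub by blast
  qed
  ultimately show ?thesis by (simp add: vertex_path_def)
qed

lemma longest_path_reverse: "longest_path G p l \<Longrightarrow> longest_path G (\<lambda>i. p (Suc l - i)) l"
  unfolding longest_path_def using vertex_path_reverse[of p l] by blast

lemma path_reverse_image: "(\<lambda>i. p (Suc l - i)) ` {1..l} = p ` {1..l::nat}"
proof -
  have "(\<lambda>i. Suc l - i) ` {1..l} = {1..l}"
  proof
    show "{1..l} \<subseteq> (\<lambda>i. Suc l - i) ` {1..l}"
    proof
      fix y assume y: "y \<in> {1..l}"
      hence "y = Suc l - (Suc l - y)" "Suc l - y \<in> {1..l}" by auto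
      thus "y \<in> (\<lambda>i. Suc l - i) ` {1..l}" by blast
    qed
  qed auto
  thus ?thesis by (metis image_image)
qed

text \<open>A neighbour off the path would prolong it.\<close>

lemma longest_path_end:
  assumes "longest_path G p l" "l \<ge> 1"
  shows "neighbours G (p l) \<subseteq> p ` {1..l}"
proof (rule ccontr)
  assume "\<not> ?thesis"
  then obtain x where x: "x \<in> neighbours G (p l)" "x \<notin> p ` {1..l}" by blast
  have vp: "vertex_path G p l" using assms by (simp add: longest_path_def)
  define q where "q i = (if i = Suc l then x else p i)" for i
  have ivl: "{1..Suc l} = insert (Suc l) {1..l}" by auto
  have qp: "q i = p i" if "i \<in> {1..l}" for i using that by (simp add: q_def)
  have qx: "q (Suc l) = x" by (simp add: q_def)
  have img: "q ` {1..l} = p ` {1..l}" using qp by (intro image_cong) auto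
  have "inj_on q {1..l}" using vp inj_on_cong[of "{1..l}" q p] qp by (simp add: vertex_path_def)
  moreover have "q (Suc l) \<notin> q ` ({1..l} - {Suc l})" using qx img x(2) by blast
  ultimately have "inj_on q {1..Suc l}" unfolding ivl inj_on_insert by blast
  moreover have "q ` {1..Suc l} \<subseteq> pverts G"
    unfolding ivl image_insert img qx using vp x(1) neighbours_subset by (auto simp: vertex_path_def)
  moreover have "q (Suc i) \<in> neighbours G (q i)" if i: "1 \<le> i" "i < Suc l" for i
  proof (cases "i = l")
    case True
    thus ?thesis using qx qp[of l] x(1) assms(2) by simp
  next
    case False
    thus ?thesis using qp[of i] qp[of "Suc i"] i vp by (simp add: vertex_path_def)
  qed
  ultimately have "vertex_path G q (Suc l)" by (simp add: vertex_path_def)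
  hence "Suc l \<le> l" using assms(1) unfolding longest_path_def by blast
  thus False by simp
qed

lemma longest_path_start:
  assumes "longest_path G p l" "l \<ge> 1"
  shows "neighbours G (p 1) \<subseteq> p ` {1..l}"
  using longest_path_end[OF longest_path_reverse[OF assms(1)] assms(2)] unfolding path_reverse_image by simp

section \<open>Longest paths when all branch vertices are forks\<close>

context
  fixes p l
  assumes lp: "longest_path G p l" and fe: "fork_ends G"
begin

lemma path: "vertex_path G p l"
  using lp by (simp add: longest_path_def)

lemma path_inj: "i \<in> {1..l} \<Longrightarrow> j \<in> {1..l} \<Longrightarrow> p i = p j \<longleftrightarrow> i = j"
  using path inj_on_eq_iff[of p "{1..l}"] unfolding vertex_path_def by blast

lemma path_vertex: "i \<in> {1..l} \<Longrightarrow> p i \<in> pverts G"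
  using path unfolding vertex_path_def by blast

lemma path_step: "1 \<le> i \<Longrightarrow> i < l \<Longrightarrow> p (Suc i) \<in> neighbours G (p i)"
  using path by (simp add: vertex_path_def)

lemma path_step': "1 < i \<Longrightarrow> i \<le> l \<Longrightarrow> p (i - 1) \<in> neighbours G (p i)"
  using path_step[of "i - 1"] neighbours_sym[of "p i" "p (i - 1)"] by simp

text \<open>Three known neighbours are enough to invoke \<open>fork_ends\<close>: they exhaust the
  neighbourhood, so the two pendant ones are among them.\<close>

lemma fork_at:
  assumes v: "v \<in> pverts G" and xyz: "{x, y, z} \<subseteq> neighbours G v" "x \<noteq> y" "x \<noteq> z" "y \<noteq> z"
  shows "neighbours G v = {x, y, z}"
    and "neighbours G x = {v} \<and> neighbours G y = {v} \<or> neighbours G x = {v} \<and> neighbours G z = {v} \<or>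
      neighbours G y = {v} \<and> neighbours G z = {v}"
proof -
  have card: "card {x, y, z} = 3" using xyz by simp
  hence "card (neighbours G v) \<ge> 3" using card_mono[OF finite_neighbours xyz(1)] by simp
  hence *: "card (neighbours G v) = 3" "\<exists>a b. a \<noteq> b \<and> a \<in> neighbours G v \<and> b \<in> neighbours G v \<and> neighbours G a = {v} \<and> neighbours G b = {v}"
    using fe v unfolding fork_ends_def by blast+
  show eq: "neighbours G v = {x, y, z}"
    using card_subset_eq[OF finite_neighbours xyz(1)] card *(1) by simp
  show "neighbours G x = {v} \<and> neighbours G y = {v} \<or> neighbours G x = {v} \<and> neighbours G z = {v} \<or>
      neighbours G y = {v} \<and> neighbours G z = {v}"
    using *(2) unfolding eq by blast
qed

text \<open>An inner vertex of the path has two neighbours on it, so a pendant vertex can only be an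
  end.\<close>

lemma path_leaf:
  assumes "neighbours G (p i) = {p j}" "i \<in> {1..l}" "j \<in> {1..l}"
  shows "j = i + 1 \<and> i = 1 \<or> j = i - 1 \<and> i = l"
proof -
  have 1: "j = i + 1" if "i < l"
    using path_step[of i] that assms path_inj[of "Suc i" j] by auto
  have 2: "j = i - 1" if "i > 1"
  proof -
    have "i - 1 \<in> {1..l}" using that assms(2) by auto
    thus ?thesis using path_step'[of i] that assms path_inj[of "i - 1" j] by auto
  qed
  show ?thesis
  proof (cases "i < l")
    case True
    hence "j = i + 1" by (rule 1)
    moreover have "i = 1"
    proof (rule ccontr)
      assume "i \<noteq> 1"
      hence "j = i - 1" using 2 assms(2) by simp
      thus False using \<open>j = i + 1\<close> by simp
    qed
    ultimately show ?thesis by simp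
  next
    case False
    hence il: "i = l" using assms(2) by simp
    show ?thesis
    proof (cases "i > 1")
      case False
      hence "i = 1" "j = 1" using il assms by auto
      thus ?thesis using assms(1) not_neighbour_self by blast
    qed (use 2 il in simp)
  qed
qed

text \<open>Ends of a longest path have no neighbours outside it, so \<open>p i\<close> is an inner
  vertex with third neighbour \<open>x\<close>, hence a fork. Two of its three neighbours are
  pendant, so at least one of these lies on the path and must be an end of it; this leaves
  \<open>i = 2\<close> and \<open>i = l - 1\<close>.\<close>

lemma off_path_neighbour:
  assumes x: "x \<in> neighbours G (p i)" "x \<notin> p ` {1..l}" and i: "i \<in> {1..l}"
  shows "1 < i" "i < l" "neighbours G (p i) = {p (i - 1), p (Suc i), x}" "neighbours G x = {p i}"
    and "i = 2 \<and> neighbours G (p 1) = {p 2} \<or> Suc i = l \<and> neighbours G (p l) = {p i}"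
proof -
  have l1: "l \<ge> 1" using i by simp
  have "i \<noteq> 1" "i \<noteq> l"
    using longest_path_start[OF lp l1] longest_path_end[OF lp l1] x by auto
  thus i1: "1 < i" and il: "i < l" using i by auto
  have nb: "{p (i - 1), p (Suc i), x} \<subseteq> neighbours G (p i)"
    using path_step[of i] path_step'[of i] i1 il x by auto
  have mem: "i - 1 \<in> {1..l}" "Suc i \<in> {1..l}" using i1 il by auto
  hence dist: "p (i - 1) \<noteq> p (Suc i)" "p (i - 1) \<noteq> x" "p (Suc i) \<noteq> x"
    using path_inj[OF mem] x(2) by auto
  note fork = fork_at[OF path_vertex[OF i] nb dist]
  show "neighbours G (p i) = {p (i - 1), p (Suc i), x}" by (rule fork(1))
  have lo: "i = 2" if "neighbours G (p (i - 1)) = {p i}"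
    using path_leaf[OF that mem(1) i] i1 il by auto
  have hi: "Suc i = l" if "neighbours G (p (Suc i)) = {p i}"
    using path_leaf[OF that mem(2) i] i1 il by auto
  show "neighbours G x = {p i}"
  proof (rule ccontr)
    assume "\<not> ?thesis"
    hence leaves: "neighbours G (p (i - 1)) = {p i}" "neighbours G (p (Suc i)) = {p i}" using fork(2) by auto
    hence i2: "i = 2" and l3: "l = 3" using lo hi by auto
    \<comment> \<open>If both pendant neighbours are on the path, then \<open>l = 3\<close>, and
      exchanging \<open>p 1\<close> for \<open>x\<close> gives another longest path. Its first
      vertex \<open>x\<close> has no neighbours off that path, so \<open>x\<close> is pendant after
      all.\<close>
    define q where "q = p(1 := x)"
    have px: "p 2 \<in> neighbours G x" using x(1) i2 neighbours_sym by blast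
    have "vertex_path G q l"
      unfolding vertex_path_def
    proof (intro conjI allI impI)
      show "inj_on q {1..l}"
        unfolding q_def using path x(2) by (intro inj_on_fun_updI) (auto simp: vertex_path_def)
      show "q ` {1..l} \<subseteq> pverts G"
        unfolding q_def using path_vertex x(1) neighbours_subset by auto
      fix j assume j: "1 \<le> j \<and> j < l"
      hence "j = 1 \<or> j = 2" using l3 by auto
      thus "q (Suc j) \<in> neighbours G (q j)"
        using px path_step[of 2] l3 by (auto simp: q_def numeral_2_eq_2)
    qed
    hence "longest_path G q l" using lp by (simp add: longest_path_def)
    from longest_path_start[OF this l1] have "neighbours G x \<subseteq> {x, p 2, p 3}"
      unfolding l3 q_def by (auto simp: image_iff numeral_2_eq_2 numeral_3_eq_3 le_Suc_eq split: if_splits)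
    moreover have "x \<notin> neighbours G x" by (rule not_neighbour_self)
    moreover have "p 3 \<notin> neighbours G x"
    proof
      assume "p 3 \<in> neighbours G x"
      hence "x \<in> neighbours G (p 3)" using neighbours_sym by blast
      hence "x = p i" using leaves(2) i2 by (simp add: numeral_3_eq_3 numeral_2_eq_2)
      thus False using x(2) i by blast
    qed
    ultimately have "neighbours G x = {p 2}" using px by blast
    thus False using \<open>neighbours G x \<noteq> {p i}\<close> i2 by simp
  qed
  from fork(2) have "neighbours G (p (i - 1)) = {p i} \<or> neighbours G (p (Suc i)) = {p i}" by blast
  thus "i = 2 \<and> neighbours G (p 1) = {p 2} \<or> Suc i = l \<and> neighbours G (p l) = {p i}"
  proof
    assume a: "neighbours G (p (i - 1)) = {p i}"
    have "i = 2" using lo[OF a] .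
    thus ?thesis using a by simp
  next
    assume a: "neighbours G (p (Suc i)) = {p i}"
    have "Suc i = l" using hi[OF a] .
    thus ?thesis using a by simp
  qed
qed

text \<open>An inner vertex at the end of a chord would have to be a fork. But neither the other end
  of the chord nor the path neighbour lying between is pendant, and only one neighbour remains. So a
  chord can only close the path to a cycle.\<close>

lemma path_chord:
  assumes "p j \<in> neighbours G (p i)" and ij: "i \<in> {1..l}" "j \<in> {1..l}" "Suc i < j"
  shows "i = 1 \<and> j = l"
proof
  show "i = 1"
  proof (rule ccontr)
    assume "i \<noteq> 1"
    hence i1: "1 < i" using ij by simp
    have mem: "i - 1 \<in> {1..l}" "Suc i \<in> {1..l}" using i1 ij by auto
    have nb: "{p (i - 1), p (Suc i), p j} \<subseteq> neighbours G (p i)"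
      using path_step[of i] path_step'[of i] i1 ij assms(1) by simp
    have dist: "p (i - 1) \<noteq> p (Suc i)" "p (i - 1) \<noteq> p j" "p (Suc i) \<noteq> p j"
      using path_inj[OF mem] path_inj[OF mem(1) ij(2)] path_inj[OF mem(2) ij(2)] ij(3) by auto
    have "neighbours G (p j) \<noteq> {p i}"
    proof
      assume "neighbours G (p j) = {p i}"
      from path_leaf[OF this ij(2,1)] show False using ij i1 by auto
    qed
    moreover have "neighbours G (p (Suc i)) \<noteq> {p i}"
    proof
      assume "neighbours G (p (Suc i)) = {p i}"
      from path_leaf[OF this mem(2) ij(1)] show False using ij i1 by auto
    qed
    ultimately show False using fork_at(2)[OF path_vertex[OF ij(1)] nb dist] by blast
  qed
  show "j = l"
  proof (rule ccontr)
    assume "j \<noteq> l"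
    hence jl: "j < l" using ij by simp
    have mem: "j - 1 \<in> {1..l}" "Suc j \<in> {1..l}" using jl ij by auto
    have nb: "{p (j - 1), p (Suc j), p i} \<subseteq> neighbours G (p j)"
      using path_step[of j] path_step'[of j] jl ij assms(1) neighbours_sym[of "p i" "p j"] by simp
    have dist: "p (j - 1) \<noteq> p (Suc j)" "p (j - 1) \<noteq> p i" "p (Suc j) \<noteq> p i"
      using path_inj[OF mem] path_inj[OF mem(1) ij(1)] path_inj[OF mem(2) ij(1)] ij(3) by auto
    have "neighbours G (p i) \<noteq> {p j}"
    proof
      assume "neighbours G (p i) = {p j}"
      from path_leaf[OF this ij(1,2)] show False using ij jl by auto
    qed
    moreover have "neighbours G (p (j - 1)) \<noteq> {p j}"
    proof
      assume "neighbours G (p (j - 1)) = {p j}"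
      from path_leaf[OF this mem(1) ij(2)] show False using ij jl by auto
    qed
    ultimately show False using fork_at(2)[OF path_vertex[OF ij(2)] nb dist] by blast
  qed
qed

text \<open>For \<open>l = 2\<close> the pair \<open>p 1\<close>, \<open>p l\<close> is an edge of
  the path itself, so a closing edge is excluded only for \<open>l >= 3\<close>.\<close>

lemma path_adjacent_iff:
  assumes "i \<in> {1..l}" "j \<in> {1..l}" and nc: "\<not> (l \<ge> 3 \<and> p l \<in> neighbours G (p 1))"
  shows "(p i, p j) \<in> parcs G \<longleftrightarrow> j = i + 1 \<or> i = j + 1"
proof
  assume e: "(p i, p j) \<in> parcs G"
  hence n1: "p j \<in> neighbours G (p i)" "p i \<in> neighbours G (p j)"
    using arcs_symmetric by (auto simp: neighbours_def)
  have "i \<noteq> j" using n1 not_neighbour_self by blast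
  show "j = i + 1 \<or> i = j + 1"
  proof (rule ccontr)
    assume "\<not> ?thesis"
    hence "Suc i < j \<or> Suc j < i" using \<open>i \<noteq> j\<close> by auto
    thus False
      using path_chord[OF n1(1) assms(1,2)] path_chord[OF n1(2) assms(2,1)] n1 nc by auto
  qed
next
  assume "j = i + 1 \<or> i = j + 1"
  thus "(p i, p j) \<in> parcs G"
    using path_step[of i] path_step[of j] assms arcs_symmetric by (auto simp: neighbours_def)
qed

end


section \<open>The four isomorphism types\<close>

lemma graph_iso_enumI:
  assumes g: "bij_betw g {1..n} (pverts G)" and H: "n \<ge> 6" "H \<in> {P_graph n, C_graph n, Y_graph n, W_graph n}"
    and arcs: "\<And>i j. i \<in> {1..n} \<Longrightarrow> j \<in> {1..n} \<Longrightarrow> (i, j) \<in> parcs H \<longleftrightarrow> (g i, g j) \<in> parcs G"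
  shows "graph_iso G H"
proof (rule graph_isoI)
  \<comment> \<open>\<open>g\<close> numbers the vertices of \<open>G\<close>; the isomorphism onto
    \<open>H\<close> is its inverse.\<close>
  show "bij_betw (the_inv_into {1..n} g) (pverts G) (pverts H)"
    using bij_betw_the_inv_into[OF g] special_graph_wf(1)[OF H] by simp
  show "parcs H \<subseteq> pverts H \<times> pverts H" by (rule special_graph_wf(2)[OF H])
  fix u v assume "u \<in> pverts G" "v \<in> pverts G"
  then obtain i j where ij: "i \<in> {1..n}" "j \<in> {1..n}" "u = g i" "v = g j"
    using g unfolding bij_betw_def by blast
  have "the_inv_into {1..n} g u = i" "the_inv_into {1..n} g v = j"
    using g ij by (auto simp: bij_betw_def the_inv_into_f_f)
  thus "(u, v) \<in> parcs G \<longleftrightarrow> (the_inv_into {1..n} g u, the_inv_into {1..n} g v) \<in> parcs H"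
    using arcs ij by simp
qed

context
  fixes p l
  assumes lp: "longest_path G p l" and fe: "fork_ends G"
begin

lemma path_inj_on: "inj_on p {1..l}"
  using lp unfolding longest_path_def vertex_path_def by blast

lemma longest_path_iso_P:
  assumes "\<not> (l \<ge> 3 \<and> p l \<in> neighbours G (p 1))" "pverts G = p ` {1..l}" "l \<ge> 6"
  shows "graph_iso G (P_graph l)"
proof (rule graph_iso_enumI[where g = p])
  show "bij_betw p {1..l} (pverts G)" using path_inj_on assms(2) by (simp add: bij_betw_def)
  show "(i, j) \<in> parcs (P_graph l) \<longleftrightarrow> (p i, p j) \<in> parcs G" if "i \<in> {1..l}" "j \<in> {1..l}" for i j
    using path_adjacent_iff[OF lp fe that assms(1)] that by (simp add: special_graph_arcs P_graph_arcs)
qed (use assms in auto)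

lemma longest_path_iso_C:
  assumes ch: "p l \<in> neighbours G (p 1)" and V: "pverts G = p ` {1..l}" and l: "l \<ge> 6"
  shows "graph_iso G (C_graph l)"
proof (rule graph_iso_enumI[where g = p])
  show "bij_betw p {1..l} (pverts G)" using path_inj_on V by (simp add: bij_betw_def)
  fix i j assume ij: "i \<in> {1..l}" "j \<in> {1..l}"
  show "(i, j) \<in> parcs (C_graph l) \<longleftrightarrow> (p i, p j) \<in> parcs G"
  proof
    assume "(i, j) \<in> parcs (C_graph l)"
    then consider "j = Suc i" | "i = Suc j" | "i = l" "j = 1" | "i = 1" "j = l"
      by (auto simp: special_graph_arcs P_graph_arcs)
    thus "(p i, p j) \<in> parcs G"
      using path_step[OF lp fe, of i] path_step[OF lp fe, of j] ij ch arcs_symmetric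
      by cases (auto simp: neighbours_def)
  next
    assume e: "(p i, p j) \<in> parcs G"
    hence n1: "p j \<in> neighbours G (p i)" "p i \<in> neighbours G (p j)"
      using arcs_symmetric by (auto simp: neighbours_def)
    have "i \<noteq> j" using n1 not_neighbour_self by blast
    then consider "j = Suc i" | "i = Suc j" | "Suc i < j" | "Suc j < i" by linarith
    thus "(i, j) \<in> parcs (C_graph l)"
      using path_chord[OF lp fe n1(1) ij] path_chord[OF lp fe n1(2) ij(2,1)] ij
      by cases (auto simp: special_graph_arcs P_graph_arcs)
  qed
qed (use l in auto)

text \<open>The extra leaf \<open>x\<close> takes number 1 and the path is shifted by one, so that
  \<open>x\<close> and \<open>p 1\<close> become vertices 1 and 2, both attached to
  \<open>p 2\<close>, which is vertex 3.\<close>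

lemma longest_path_iso_Y:
  assumes nc: "\<not> (l \<ge> 3 \<and> p l \<in> neighbours G (p 1))" and V: "pverts G = insert x (p ` {1..l})"
    and l: "l \<ge> 5" and x: "x \<notin> p ` {1..l}" "neighbours G x = {p 2}"
  shows "graph_iso G (Y_graph (Suc l))"
proof -
  define g where "g i = (if i = 1 then x else p (i - 1))" for i :: nat
  have gi: "g i = p (i - 1) \<and> i - 1 \<in> {1..l}" if "i \<in> {1..Suc l}" "i \<noteq> 1" for i
    using that by (auto simp: g_def)
  have xp: "(x, p i) \<in> parcs G \<longleftrightarrow> i = 2" "(p i, x) \<in> parcs G \<longleftrightarrow> i = 2" if "i \<in> {1..l}" for i
  proof -
    have "(x, p i) \<in> parcs G \<longleftrightarrow> p i \<in> neighbours G x" by (simp add: neighbours_def)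
    also have "\<dots> \<longleftrightarrow> i = 2" unfolding x(2) using path_inj[OF lp fe that, of 2] l by simp
    finally show "(x, p i) \<in> parcs G \<longleftrightarrow> i = 2" .
    thus "(p i, x) \<in> parcs G \<longleftrightarrow> i = 2" using arcs_symmetric by blast
  qed
  have xx: "(x, x) \<notin> parcs G" using not_neighbour_self[of x] by (simp add: neighbours_def)
  show ?thesis
  proof (rule graph_iso_enumI[where g = g])
    have "inj_on g {1..Suc l}"
    proof (rule inj_onI)
      fix i j assume ij: "i \<in> {1..Suc l}" "j \<in> {1..Suc l}" "g i = g j"
      show "i = j"
      proof (cases "i = 1 \<or> j = 1")
        case True
        thus ?thesis using ij gi[of i] gi[of j] x(1) by (auto simp: g_def split: if_splits)
      next
        case False
        hence "p (i - 1) = p (j - 1)" using ij(3) by (simp add: g_def)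
        hence "i - 1 = j - 1" using path_inj[OF lp fe, of "i - 1" "j - 1"] gi ij False by simp
        thus ?thesis using ij False by auto
      qed
    qed
    moreover have "g ` {1..Suc l} = insert x (p ` {1..l})"
    proof
      show "g ` {1..Suc l} \<subseteq> insert x (p ` {1..l})" using gi by (force simp: g_def)
      have "p i \<in> g ` {1..Suc l}" if "i \<in> {1..l}" for i
        by (rule image_eqI[of _ _ "Suc i"]) (use that in \<open>auto simp: g_def\<close>)
      moreover have "x \<in> g ` {1..Suc l}" by (rule image_eqI[of _ _ 1]) (auto simp: g_def)
      ultimately show "insert x (p ` {1..l}) \<subseteq> g ` {1..Suc l}" by blast
    qed
    ultimately show "bij_betw g {1..Suc l} (pverts G)" using V by (simp add: bij_betw_def)
    fix i j assume ij: "i \<in> {1..Suc l}" "j \<in> {1..Suc l}"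
    consider "i = 1" "j = 1" | "i = 1" "j \<noteq> 1" | "i \<noteq> 1" "j = 1" | "i \<noteq> 1" "j \<noteq> 1" by blast
    thus "(i, j) \<in> parcs (Y_graph (Suc l)) \<longleftrightarrow> (g i, g j) \<in> parcs G"
    proof cases
      case 1
      thus ?thesis using xx by (simp add: special_graph_arcs P_graph_arcs g_def)
    next
      case 2
      hence "(g i, g j) \<in> parcs G \<longleftrightarrow> j - 1 = 2" using xp(1)[of "j - 1"] gi[OF ij(2)] by (simp add: g_def)
      thus ?thesis using 2 l by (auto simp: special_graph_arcs P_graph_arcs)
    next
      case 3
      hence "(g i, g j) \<in> parcs G \<longleftrightarrow> i - 1 = 2" using xp(2)[of "i - 1"] gi[OF ij(1)] by (simp add: g_def)
      thus ?thesis using 3 l by (auto simp: special_graph_arcs P_graph_arcs)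
    next
      case 4
      hence "(g i, g j) \<in> parcs G \<longleftrightarrow> j - 1 = i - 1 + 1 \<or> i - 1 = j - 1 + 1"
        using path_adjacent_iff[OF lp fe _ _ nc, of "i - 1" "j - 1"] gi[OF ij(1)] gi[OF ij(2)] by simp
      thus ?thesis using 4 ij by (auto simp: special_graph_arcs P_graph_arcs)
    qed
  qed (use l in auto)
qed

text \<open>As for \<open>Y_graph\<close>, with the second leaf \<open>y\<close> numbered last: for
  \<open>n = l + 2\<close>, \<open>p l\<close> and \<open>y\<close> become vertices
  \<open>n - 1\<close> and \<open>n\<close>, both attached to \<open>p (l - 1)\<close>, which is
  vertex \<open>n - 2\<close>. From \<open>l >= 4\<close> on the two forks are distinct.\<close>

lemma longest_path_iso_W:
  assumes nc: "\<not> (l \<ge> 3 \<and> p l \<in> neighbours G (p 1))" and V: "pverts G = {x, y} \<union> p ` {1..l}"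
    and l: "l \<ge> 4" and x: "x \<notin> p ` {1..l}" "neighbours G x = {p 2}"
    and y: "y \<notin> p ` {1..l}" "neighbours G y = {p (l - 1)}"
  shows "graph_iso G (W_graph (l + 2))"
proof -
  define g where "g i = (if i = 1 then x else if i = l + 2 then y else p (i - 1))" for i :: nat
  have gi: "g i = p (i - 1) \<and> i - 1 \<in> {1..l}" if "i \<in> {1..l + 2}" "i \<noteq> 1" "i \<noteq> l + 2" for i
    using that by (auto simp: g_def)
  have l1: "l - 1 \<in> {1..l}" "2 \<in> {1..l}" using l by auto
  have sym: "(a, b) \<in> parcs G \<longleftrightarrow> (b, a) \<in> parcs G" for a b using arcs_symmetric by blast
  have xp: "(x, p i) \<in> parcs G \<longleftrightarrow> i = 2" and yp: "(y, p i) \<in> parcs G \<longleftrightarrow> i = l - 1" if "i \<in> {1..l}" for i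
  proof -
    have "(x, p i) \<in> parcs G \<longleftrightarrow> p i \<in> neighbours G x" "(y, p i) \<in> parcs G \<longleftrightarrow> p i \<in> neighbours G y"
      by (simp_all add: neighbours_def)
    thus "(x, p i) \<in> parcs G \<longleftrightarrow> i = 2" "(y, p i) \<in> parcs G \<longleftrightarrow> i = l - 1"
      unfolding x(2) y(2) using path_inj[OF lp fe that l1(1)] path_inj[OF lp fe that l1(2)] by simp_all
  qed
  have xy: "x \<noteq> y"
    using x(2) y(2) path_inj[OF lp fe l1] l by auto
  have xx: "(x, x) \<notin> parcs G" "(y, y) \<notin> parcs G"
    using not_neighbour_self by (auto simp: neighbours_def)
  have "y \<notin> neighbours G x" unfolding x(2) using y(1) l1(2) by blast
  hence nxy: "(x, y) \<notin> parcs G" by (simp add: neighbours_def)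
  show ?thesis
  proof (rule graph_iso_enumI[where g = g])
    have "inj_on g {1..l + 2}"
    proof (rule inj_onI)
      fix i j assume ij: "i \<in> {1..l + 2}" "j \<in> {1..l + 2}" "g i = g j"
      show "i = j"
      proof (cases "i = 1 \<or> j = 1 \<or> i = l + 2 \<or> j = l + 2")
        case True
        have "g m \<in> p ` {1..l}" if "m \<in> {1..l + 2}" "m \<noteq> 1" "m \<noteq> l + 2" for m
          using gi[OF that] by simp
        from this[OF ij(1)] this[OF ij(2)] show ?thesis using True ij(3) x(1) y(1) xy l
          by (auto simp: g_def split: if_splits)
      next
        case False
        hence "p (i - 1) = p (j - 1)" using ij(3) by (simp add: g_def)
        hence "i - 1 = j - 1" using path_inj[OF lp fe, of "i - 1" "j - 1"] gi ij False by simp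
        thus ?thesis using ij False by auto
      qed
    qed
    moreover have "g ` {1..l + 2} = {x, y} \<union> p ` {1..l}"
    proof
      show "g ` {1..l + 2} \<subseteq> {x, y} \<union> p ` {1..l}" using gi by (force simp: g_def)
      have "p i \<in> g ` {1..l + 2}" if "i \<in> {1..l}" for i
        by (rule image_eqI[of _ _ "Suc i"]) (use that in \<open>auto simp: g_def\<close>)
      moreover have "x \<in> g ` {1..l + 2}" by (rule image_eqI[of _ _ 1]) (auto simp: g_def)
      moreover have "y \<in> g ` {1..l + 2}" by (rule image_eqI[of _ _ "l + 2"]) (auto simp: g_def)
      ultimately show "{x, y} \<union> p ` {1..l} \<subseteq> g ` {1..l + 2}" by blast
    qed
    ultimately show "bij_betw g {1..l + 2} (pverts G)" using V by (simp add: bij_betw_def)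
    \<comment> \<open>Both graphs are symmetric, so the pairs with \<open>i <= j\<close> suffice;
      this roughly halves the cases.\<close>
    have main: "(i, j) \<in> parcs (W_graph (l + 2)) \<longleftrightarrow> (g i, g j) \<in> parcs G"
      if ij: "i \<in> {1..l + 2}" "j \<in> {1..l + 2}" "i \<le> j" for i j
    proof -
      consider "i = 1" "j = 1" | "i = 1" "j = l + 2" | "i = l + 2" "j = l + 2"
        | "i = 1" "j \<noteq> 1" "j \<noteq> l + 2" | "i \<noteq> 1" "i \<noteq> l + 2" "j = l + 2"
        | "i \<noteq> 1" "i \<noteq> l + 2" "j \<noteq> 1" "j \<noteq> l + 2" using ij by fastforce
      thus ?thesis
      proof cases
        case 1
        thus ?thesis using xx l by (simp add: special_graph_arcs P_graph_arcs g_def)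
      next
        case 2
        thus ?thesis using nxy l by (simp add: special_graph_arcs P_graph_arcs g_def)
      next
        case 3
        thus ?thesis using xx l by (simp add: special_graph_arcs P_graph_arcs g_def)
      next
        case 4
        hence "(g i, g j) \<in> parcs G \<longleftrightarrow> j - 1 = 2" using xp[of "j - 1"] gi[OF ij(2)] by (simp add: g_def)
        thus ?thesis using 4 l by (auto simp: special_graph_arcs P_graph_arcs)
      next
        case 5
        hence "(g i, g j) \<in> parcs G \<longleftrightarrow> i - 1 = l - 1"
          using yp[of "i - 1"] gi[OF ij(1)] l sym[of "g i" y] by (simp add: g_def)
        thus ?thesis using 5 l ij(1) by (auto simp: special_graph_arcs P_graph_arcs)
      next
        case 6
        hence "(g i, g j) \<in> parcs G \<longleftrightarrow> j - 1 = i - 1 + 1 \<or> i - 1 = j - 1 + 1"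
          using path_adjacent_iff[OF lp fe _ _ nc, of "i - 1" "j - 1"] gi[OF ij(1)] gi[OF ij(2)] by simp
        thus ?thesis using 6 ij l by (auto simp: special_graph_arcs P_graph_arcs)
      qed
    qed
    fix i j assume ij: "i \<in> {1..l + 2}" "j \<in> {1..l + 2}"
    have symW: "(i, j) \<in> parcs (W_graph (l + 2)) \<longleftrightarrow> (j, i) \<in> parcs (W_graph (l + 2))"
      by (auto simp: special_graph_arcs P_graph_arcs)
    show "(i, j) \<in> parcs (W_graph (l + 2)) \<longleftrightarrow> (g i, g j) \<in> parcs G"
    proof (cases "i \<le> j")
      case True
      thus ?thesis using main ij by blast
    next
      case False
      hence "(j, i) \<in> parcs (W_graph (l + 2)) \<longleftrightarrow> (g j, g i) \<in> parcs G" using main ij by simp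
      thus ?thesis using symW sym by blast
    qed
  qed (use l in auto)
qed

end

text \<open>A longest path and the vertices attached to it already form a closed set, because the
  attached vertices are pendant. The order is then \<open>l + card X\<close> with
  \<open>card X <= 2\<close>.\<close>

theorem fork_ends_iso:
  assumes con: "Digraph_Component.connected (with_proj G)" and fe: "fork_ends G"
    and n: "card (pverts G) = n" "n \<ge> 6"
  shows "graph_iso G (Y_graph n) \<or> graph_iso G (W_graph n) \<or> graph_iso G (P_graph n) \<or> graph_iso G (C_graph n)"
proof -
  have "pverts G \<noteq> {}" using n by auto
  then obtain p l where lp: "longest_path G p l" and l1: "l \<ge> 1" using longest_path_exists by blast
  define P where "P = p ` {1..l}"
  define X where "X = {x. x \<notin> P \<and> (\<exists>i\<in>{1..l}. x \<in> neighbours G (p i))}"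
  note off = off_path_neighbour[OF lp fe, folded P_def]
  have PV: "P \<subseteq> pverts G" unfolding P_def using path_vertex[OF lp fe] by blast
  have XV: "X \<subseteq> pverts G" unfolding X_def using neighbours_subset by blast
  have cardP: "card P = l" unfolding P_def using card_image[OF path_inj_on[OF lp fe]] by simp
  have finX: "finite X" using finite_subset[OF XV pair_finite_verts] .
  have V: "P \<union> X = pverts G"
  proof (rule connected_closed_eq[OF con])
    show "P \<union> X \<noteq> {}" using l1 by (auto simp: P_def)
    fix v assume "v \<in> P \<union> X"
    thus "neighbours G v \<subseteq> P \<union> X"
    proof
      assume "v \<in> P"
      thus ?thesis unfolding X_def by (auto simp: P_def)
    next
      assume "v \<in> X"
      then obtain i where i: "i \<in> {1..l}" "v \<in> neighbours G (p i)" "v \<notin> P" by (auto simp: X_def)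
      thus ?thesis using off(4)[OF i(2,3,1)] by (auto simp: P_def)
    qed
  qed (use PV XV in auto)
  have "P \<inter> X = {}" by (auto simp: X_def)
  hence nl: "n = l + card X"
    using card_Un_disjoint[of P X] finX cardP V n(1) finite_subset[OF PV pair_finite_verts] by simp
  \<comment> \<open>Besides naming the two possible places of attachment, \<open>A\<close> and
    \<open>B\<close> record that the adjacent end of the path is pendant; this is what excludes a
    closing edge in the presence of a fork.\<close>
  define A where "A = {x \<in> X. x \<in> neighbours G (p 2) \<and> neighbours G x = {p 2} \<and> neighbours G (p 1) = {p 2}}"
  define B where "B = {x \<in> X. x \<in> neighbours G (p (l - 1)) \<and> neighbours G x = {p (l - 1)} \<and> neighbours G (p l) = {p (l - 1)}}"
  have XAB: "(x \<in> A \<or> x \<in> B) \<and> l \<ge> 3" if "x \<in> X" for x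
  proof -
    obtain i where i: "i \<in> {1..l}" "x \<in> neighbours G (p i)" "x \<notin> P" using \<open>x \<in> X\<close> by (auto simp: X_def)
    note o = off[OF i(2,3,1)]
    have "l \<ge> 3" using o(1,2) by linarith
    from o(5) show ?thesis
    proof
      assume "i = 2 \<and> neighbours G (p 1) = {p 2}"
      thus ?thesis using o(4) i that \<open>l \<ge> 3\<close> by (simp add: A_def)
    next
      assume "Suc i = l \<and> neighbours G (p l) = {p i}"
      moreover from this have "i = l - 1" by linarith
      ultimately show ?thesis using o(4) i that \<open>l \<ge> 3\<close> by (simp add: B_def)
    qed
  qed
  have uniqA: "x = y" if "x \<in> A" "y \<in> A" for x y
  proof -
    have xX: "x \<in> X" "y \<in> X" using that by (auto simp: A_def)
    hence l3: "l \<ge> 3" using XAB by blast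
    have "x \<notin> P" "y \<notin> P" using xX by (auto simp: X_def)
    hence "neighbours G (p 2) = {p 1, p 3, x}"
      using off(3)[of x 2] that(1) l3 by (simp add: A_def numeral_3_eq_3)
    hence "y \<in> {p 1, p 3, x}" using that(2) by (auto simp: A_def)
    moreover have "p 1 \<in> P" "p 3 \<in> P" using l3 by (auto simp: P_def)
    ultimately show ?thesis using \<open>y \<notin> P\<close> by auto
  qed
  have uniqB: "x = y" if "x \<in> B" "y \<in> B" for x y
  proof -
    have xX: "x \<in> X" "y \<in> X" using that by (auto simp: B_def)
    hence l3: "l \<ge> 3" using XAB by blast
    have nP: "x \<notin> P" "y \<notin> P" using xX by (auto simp: X_def)
    have mem: "l - 1 \<in> {1..l}" "l - 1 - 1 \<in> {1..l}" "Suc (l - 1) \<in> {1..l}" using l3 by auto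
    have "neighbours G (p (l - 1)) = {p (l - 1 - 1), p (Suc (l - 1)), x}"
      using off(3)[OF _ nP(1) mem(1)] that(1) by (simp add: B_def)
    hence "y \<in> {p (l - 1 - 1), p (Suc (l - 1)), x}" using that(2) unfolding B_def by blast
    moreover have "p (l - 1 - 1) \<in> P" "p (Suc (l - 1)) \<in> P" unfolding P_def using mem by blast+
    ultimately show ?thesis using nP(2) by auto
  qed
  have X: "X = A \<union> B" using XAB by (auto simp: A_def B_def)
  have finAB: "finite A" "finite B" using finX X by auto
  have cA: "card A \<le> 1" "card B \<le> 1"
    using uniqA uniqB finAB by (auto simp: card_le_Suc0_iff_eq)
  \<comment> \<open>From \<open>n >= 6\<close> and at most one attached vertex at either end, the
    path has at least 4 vertices. Its second and its last but one vertex are then different, so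
    \<open>A\<close> and \<open>B\<close> are disjoint.\<close>
  have "card X \<le> card A + card B" unfolding X by (rule card_Un_le)
  hence l4: "l \<ge> 4" using nl n(2) cA by linarith
  have AP: "x \<notin> P" if "x \<in> A \<or> x \<in> B" for x using that by (auto simp: A_def B_def X_def)
  have AB: "A \<inter> B = {}"
  proof (rule ccontr)
    assume "A \<inter> B \<noteq> {}"
    then obtain x where "x \<in> A" "x \<in> B" by blast
    hence "p 2 = p (l - 1)" by (auto simp: A_def B_def)
    moreover have "2 \<in> {1..l}" "l - 1 \<in> {1..l}" using l4 by auto
    ultimately have "2 = l - 1" using path_inj[OF lp fe] by blast
    thus False using l4 by linarith
  qed
  show ?thesis
  proof (cases "l \<ge> 3 \<and> p l \<in> neighbours G (p 1)")
    case True
    have "A = {}"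
    proof (rule ccontr)
      assume "A \<noteq> {}"
      hence "neighbours G (p 1) = {p 2}" by (auto simp: A_def)
      thus False using True path_inj[OF lp fe, of l 2] l4 by auto
    qed
    moreover have "B = {}"
    proof (rule ccontr)
      assume "B \<noteq> {}"
      hence "neighbours G (p l) = {p (l - 1)}" by (auto simp: B_def)
      hence "p 1 \<in> {p (l - 1)}" using True neighbours_sym by blast
      moreover have "1 \<in> {1..l}" "l - 1 \<in> {1..l}" using l4 by auto
      ultimately have "1 = l - 1" using path_inj[OF lp fe] by blast
      thus False using l4 by linarith
    qed
    ultimately have "X = {}" using X by simp
    hence "graph_iso G (C_graph n)" using longest_path_iso_C[OF lp fe] True V nl n(2) by (simp add: P_def)
    thus ?thesis by blast
  next
    case False
    have sing: "(S = {} \<or> (\<exists>x. S = {x}))" if "card S \<le> 1" "finite S" for S :: "'a set"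
      using that by (metis card_0_eq card_1_singletonE le_Suc_eq le_zero_eq One_nat_def)
    consider "A = {}" "B = {}" | x where "A = {x}" "B = {}" | x where "A = {}" "B = {x}"
      | x y where "A = {x}" "B = {y}"
      using sing[OF cA(1) finAB(1)] sing[OF cA(2) finAB(2)] by blast
    thus ?thesis
    proof cases
      case 1
      hence "graph_iso G (P_graph n)" using longest_path_iso_P[OF lp fe False] V nl n(2) X by (simp add: P_def)
      thus ?thesis by blast
    next
      case (2 x)
      have "x \<in> A" using 2 by simp
      hence "x \<notin> p ` {1..l}" "neighbours G x = {p 2}" using AP by (auto simp: A_def P_def)
      moreover have "pverts G = insert x (p ` {1..l})" using V X 2 by (auto simp: P_def)
      moreover have "n = Suc l" using nl X 2 by simp
      ultimately have "graph_iso G (Y_graph n)" using longest_path_iso_Y[OF lp fe False, of x] n(2) by simp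
      thus ?thesis by blast
    next
      case (3 x)
      \<comment> \<open>Read backwards, the path has its fork at the start.\<close>
      let ?q = "\<lambda>i. p (Suc l - i)"
      have "x \<in> B" using 3 by simp
      hence "x \<notin> p ` {1..l}" "neighbours G x = {?q 2}" using AP by (auto simp: B_def P_def numeral_2_eq_2)
      moreover have "pverts G = insert x (p ` {1..l})" using V X 3 by (auto simp: P_def)
      moreover have "n = Suc l" using nl X 3 by simp
      moreover have "\<not> (3 \<le> l \<and> ?q l \<in> neighbours G (?q 1))" using False neighbours_sym by simp
      ultimately have "graph_iso G (Y_graph n)"
        using longest_path_iso_Y[OF longest_path_reverse[OF lp] fe, of x, unfolded path_reverse_image] n(2) by simp
      thus ?thesis by blast
    next
      case (4 x y)
      have "x \<in> A" "y \<in> B" using 4 by auto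
      hence "x \<notin> p ` {1..l}" "neighbours G x = {p 2}" "y \<notin> p ` {1..l}" "neighbours G y = {p (l - 1)}"
        using AP by (auto simp: A_def B_def P_def)
      moreover have "pverts G = {x, y} \<union> p ` {1..l}" using V X 4 by (auto simp: P_def)
      moreover have "n = l + 2" using nl X 4 AB by (simp add: card_insert_if)
      ultimately have "graph_iso G (W_graph n)" using longest_path_iso_W[OF lp fe False, of x y] l4 by simp
      thus ?thesis by blast
    qed
  qed
qed

end

theorem theorem3p9:
  fixes G :: "'a pair_pre_digraph" and n k :: nat
  assumes "k \<ge> 2"
    and "pair_graph G"
    and "Digraph_Component.connected (with_proj G)"
    and "card (pverts G) = n"
    and "real n \<ge> (2 * real k + 1) powi (20 + 23 * (int k - 1) * r_eps 0.0097 k)"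
  shows "eigenvalue_sum k G < 2 * real k \<longleftrightarrow>
    graph_iso G (Y_graph n) \<or> graph_iso G (W_graph n) \<or>
    graph_iso G (P_graph n) \<or> graph_iso G (C_graph n)"
proof -
  interpret pair_graph G by fact
  have "(2 * real k + 1) powi 2 \<le> (2 * real k + 1) powi (20 + 23 * (int k - 1) * r_eps 0.0097 k)"
  proof (rule power_int_increasing)
    have "0 \<le> 23 * (int k - 1) * r_eps 0.0097 k"
      using assms(1) r_eps_properties(1)[OF assms(1)] by (intro mult_nonneg_nonneg) linarith+
    thus "2 \<le> 20 + 23 * (int k - 1) * r_eps 0.0097 k" by linarith
  qed auto
  hence "(2 * real k + 1) powi 2 \<le> real n" using assms(5) by (rule order_trans)
  hence "real ((2 * k + 1)\<^sup>2) \<le> real n" by (simp add: add.commute)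
  hence "(2 * k + 1)\<^sup>2 \<le> n" by (simp only: of_nat_le_iff)
  \<comment> \<open>Splitting off \<open>k\<close> exhibits both \<open>k <= n\<close> and, from
    \<open>k >= 2\<close>, \<open>n >= 6\<close>, the order from which \<open>W_graph\<close> is
    meaningful.\<close>
  moreover have "(2 * k + 1)\<^sup>2 = k + (4 * k * k + 3 * k + 1)" by (simp add: power2_eq_square algebra_simps)
  ultimately have n: "n \<ge> 6" "k \<le> n" using assms(1) by linarith+
  show ?thesis
  proof
    assume "eigenvalue_sum k G < 2 * real k"
    hence "fork_ends G" using eigenvalue_sum_ge_not_fork_ends[OF assms(3,1)] assms(4,5) by force
    thus "graph_iso G (Y_graph n) \<or> graph_iso G (W_graph n) \<or> graph_iso G (P_graph n) \<or> graph_iso G (C_graph n)"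
      using fork_ends_iso[OF assms(3) _ assms(4) n(1)] by blast
  next
    assume "graph_iso G (Y_graph n) \<or> graph_iso G (W_graph n) \<or> graph_iso G (P_graph n) \<or> graph_iso G (C_graph n)"
    then obtain H where "graph_iso G H" "H \<in> {P_graph n, C_graph n, Y_graph n, W_graph n}" by blast
    thus "eigenvalue_sum k G < 2 * real k"
      using eigenvalue_sum_less_special[OF assms(3) _ assms(1) _ n(1)] n(2) assms(4) by blast
  qed
qed

end
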